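(* There is an algorithm that, given a strongly connected digraph $D$ on $n$ vertices and a positive integer $k$, decides in time $2^{O(k\log^2 k)}\cdot n^{O(1)}$ whether $D$ contains an out-branching with at least $k$ leaves. In other words, on strongly connected digraphs the problem $k$-DMLOB can be solved in time $2^{O(k\log^2 k)}\cdot n^{O(1)}$.
   Context: Digraphs are finite, without loops and without parallel arcs (directed 2-cycles are allowed). A subdigraph $T$ of $D$ is an out-tree if $T$ is an oriented tree (its underlying undirected graph is a tree) with exactly one vertex of in-degree zero in $T$, called the root. An out-branching of $D$ is an out-tree $T$ in $D$ with $V(T)=V(D)$. The leaves of $T$ are the vertices of out-degree zero in $T$. The parameterized problem $k$-DMLOB (Directed Maximum Leaf Out-Branching) is: given a digraph $D$ and a positive integer parameter $k$, does $D$ contain an out-branching with at least $k$ leaves? *)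

theory Defs
  imports "Graph_Theory.Graph_Theory" "HOL-Library.Landau_Symbols"
begin

section \<open>Out-branchings\<close>

text \<open>
  The library predicate \<open>tree\<close> cannot be used here: on a digraph \<open>forest\<close> only excludes
  directed cycles. A cycle of the underlying undirected graph is a closed walk of length at
  least 3 without repeated vertices in the symmetric closure; the closed walks of length 2
  there run back and forth along a single edge.
\<close>

definition oriented_tree :: "('a, 'b) pre_digraph \<Rightarrow> bool" where
  "oriented_tree T \<longleftrightarrow> digraph T \<and>
     (\<forall>u v. u \<rightarrow>\<^bsub>T\<^esub> v \<longrightarrow> \<not> v \<rightarrow>\<^bsub>T\<^esub> u) \<and>
     connected T \<and>
     \<not> (\<exists>p. pre_digraph.cycle (with_proj (mk_symmetric T)) p \<and> 3 \<le> length p)"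

definition out_tree :: "('a, 'b) pre_digraph \<Rightarrow> bool" where
  "out_tree T \<longleftrightarrow> oriented_tree T \<and> (\<exists>!r. r \<in> verts T \<and> in_degree T r = 0)"

definition out_branching :: "('a, 'b) pre_digraph \<Rightarrow> ('a, 'b) pre_digraph \<Rightarrow> bool" where
  "out_branching T D \<longleftrightarrow> out_tree T \<and> subgraph T D \<and> verts T = verts D"

definition leaves :: "('a, 'b) pre_digraph \<Rightarrow> 'a set" where
  "leaves T = {v \<in> verts T. out_degree T v = 0}"

definition has_leafy_out_branching :: "('a, 'b) pre_digraph \<Rightarrow> nat \<Rightarrow> bool" where
  "has_leafy_out_branching D k \<longleftrightarrow> (\<exists>T. out_branching T D \<and> k \<le> card (leaves T))"


section \<open>Random access machine programs and their running time\<close>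

text \<open>
  Algorithms are structured programs for a random access machine. The memory consists of named,
  unbounded arrays of natural numbers; the scalar variable \<open>x\<close> is the cell \<open>x[0]\<close>. A program
  mentions only finitely many arrays, and indirect addressing is possible through computed
  indices. Every elementary operation costs one time unit. There is no multiplication:
  apart from the constants of the program, one operation lengthens the binary representation
  of the largest number by at most one bit, so that the model is polynomially equivalent to Turing machines.
\<close>

type_synonym store = "string \<Rightarrow> nat \<Rightarrow> nat"

datatype aexp = Const nat | Read string aexp | Add aexp aexp | Sub aexp aexp

datatype bexp = Less aexp aexp | Neg bexp | Conj bexp bexp

datatype com =
    Skip
  | Write string aexp aexp
  | Seq com com
  | If bexp com com
  | While bexp com

text \<open>Subtraction is truncated at 0.\<close>

primrec aval :: "aexp \<Rightarrow> store \<Rightarrow> nat" where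
  "aval (Const m) s = m"
| "aval (Read x a) s = s x (aval a s)"
| "aval (Add a b) s = aval a s + aval b s"
| "aval (Sub a b) s = aval a s - aval b s"

primrec bval :: "bexp \<Rightarrow> store \<Rightarrow> bool" where
  "bval (Less a b) s \<longleftrightarrow> aval a s < aval b s"
| "bval (Neg b) s \<longleftrightarrow> \<not> bval b s"
| "bval (Conj b c) s \<longleftrightarrow> bval b s \<and> bval c s"

primrec acost :: "aexp \<Rightarrow> nat" where
  "acost (Const m) = 1"
| "acost (Read x a) = 1 + acost a"
| "acost (Add a b) = 1 + acost a + acost b"
| "acost (Sub a b) = 1 + acost a + acost b"

primrec bcost :: "bexp \<Rightarrow> nat" where
  "bcost (Less a b) = 1 + acost a + acost b"
| "bcost (Neg b) = 1 + bcost b"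
| "bcost (Conj b c) = 1 + bcost b + bcost c"

text \<open>
  \<open>exec c s t s'\<close>: started in store \<open>s\<close>, the program \<open>c\<close> halts after exactly \<open>t\<close> time units in
  store \<open>s'\<close>. In \<open>Write x i a\<close> the index is \<open>i\<close> and the value written is \<open>a\<close>.
\<close>

inductive exec :: "com \<Rightarrow> store \<Rightarrow> nat \<Rightarrow> store \<Rightarrow> bool" where
  Skip: "exec Skip s 1 s"
| Write: "exec (Write x i a) s (1 + acost i + acost a) (s(x := (s x)(aval i s := aval a s)))"
| Seq: "exec c1 s1 t1 s2 \<Longrightarrow> exec c2 s2 t2 s3 \<Longrightarrow> exec (Seq c1 c2) s1 (t1 + t2) s3"
| IfTrue: "bval b s \<Longrightarrow> exec c1 s t s' \<Longrightarrow> exec (If b c1 c2) s (1 + bcost b + t) s'"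
| IfFalse: "\<not> bval b s \<Longrightarrow> exec c2 s t s' \<Longrightarrow> exec (If b c1 c2) s (1 + bcost b + t) s'"
| WhileFalse: "\<not> bval b s \<Longrightarrow> exec (While b c) s (1 + bcost b) s"
| WhileTrue: "bval b s1 \<Longrightarrow> exec c s1 t1 s2 \<Longrightarrow> exec (While b c) s2 t2 s3 \<Longrightarrow>
    exec (While b c) s1 (1 + bcost b + t1 + t2) s3"

text \<open>Programs are deterministic, so halting time and result are functions of the input.\<close>

lemma exec_deterministic:
  "exec c s t s' \<Longrightarrow> exec c s u s'' \<Longrightarrow> t = u \<and> s' = s''"
proof (induction arbitrary: u s'' rule: exec.induct)
  case (Skip s)
  from Skip show ?case by cases simp
next
  case (Write x i a s)
  from Write show ?case by cases simp
next
  case (Seq c1 s1 t1 s2 c2 t2 s3)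
  from Seq.prems show ?case
  proof cases
    case (Seq u1 r u2)
    then show ?thesis using Seq.IH(1)[of u1 r] Seq.IH(2)[of u2 s''] by simp
  qed
next
  case (IfTrue b s c1 t s' c2)
  from IfTrue.prems show ?case
  proof cases
    case (IfTrue v)
    then show ?thesis using IfTrue.IH[of v s''] by simp
  qed (use IfTrue.hyps in simp)
next
  case (IfFalse b s c2 t s' c1)
  from IfFalse.prems show ?case
  proof cases
    case (IfFalse v)
    then show ?thesis using IfFalse.IH[of v s''] by simp
  qed (use IfFalse.hyps in simp)
next
  case (WhileFalse b s c)
  from WhileFalse.prems show ?case by cases (use WhileFalse.hyps in simp_all)
next
  case (WhileTrue b s1 c t1 s2 t2 s3)
  from WhileTrue.prems show ?case
  proof cases
    case (WhileTrue u1 r u2)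
    then show ?thesis using WhileTrue.IH(1)[of u1 r] WhileTrue.IH(2)[of u2 s''] by simp
  qed (use WhileTrue.hyps in simp)
qed


section \<open>Input and output\<close>

text \<open>
  The input is a digraph on the vertices \<open>0, \<dots>, n - 1\<close>, given by a list of its
  arcs, together with the parameter \<open>k\<close>. All cells that hold no input are 0.
\<close>

definition lists_arcs :: "(nat \<times> nat) list \<Rightarrow> nat pair_pre_digraph \<Rightarrow> bool" where
  "lists_arcs es D \<longleftrightarrow> distinct es \<and> set es = parcs D"

definition init_store :: "nat \<Rightarrow> (nat \<times> nat) list \<Rightarrow> nat \<Rightarrow> store" where
  "init_store n es k = (\<lambda>x i. 0)
     (''n'' := (\<lambda>i. 0)(0 := n),
      ''m'' := (\<lambda>i. 0)(0 := length es),
      ''k'' := (\<lambda>i. 0)(0 := k),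
      ''tail'' := (\<lambda>i. if i < length es then fst (es ! i) else 0),
      ''head'' := (\<lambda>i. if i < length es then snd (es ! i) else 0))"

definition answer :: "store \<Rightarrow> nat" where
  "answer s = s ''out'' 0"

end

theory Submission
  imports Defs
begin

text \<open>
  On a strongly connected digraph a leafy out-branching exists iff for some root \<open>r\<close> and some set
  \<open>X\<close> of inner vertices at least \<open>k\<close> vertices outside \<open>X\<close> are reachable from \<open>r\<close> along arcs
  that leave \<open>X\<close>: a spanning arborescence of these arcs extends to all of \<open>D\<close> without losing
  leaves. The set \<open>X\<close> is found by the branching algorithm of Kneis, Langer and Rossmanith. A
  partial solution keeps a stack of frontier vertices; the top one is either declared a leaf or
  becomes inner, and in the latter case all its unvisited out-neighbours join the frontier. If
  there is only one such neighbour \<open>w\<close>, then \<open>w\<close> may be taken to be inner too, since otherwise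
  its parent could have been the leaf. So every binary decision decreases
  \<open>2 k - 2 |leaves| - |frontier|\<close>, and at most \<open>2 k\<close> decisions are made. Instead of recursing,
  the program tries all \<open>4 ^ k\<close> sequences of decisions for every root.
\<close>

section \<open>Sets of inner vertices\<close>

text \<open>\<open>X\<close> is arbitrary: members of \<open>X\<close> that are never reached affect
  neither \<open>reach E r X\<close> nor the leaf set \<open>reach E r X - X\<close>.\<close>

definition reach :: "('a \<times> 'a) set \<Rightarrow> 'a \<Rightarrow> 'a set \<Rightarrow> 'a set" where
  "reach E r X = {(a, b) \<in> E. a \<in> X}\<^sup>* `` {r}"

lemma root_in_reach [simp]: "r \<in> reach E r X"
  by (simp add: reach_def)

lemma reach_step:
  assumes "a \<in> reach E r X" "a \<in> X" "(a, b) \<in> E"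
  shows "b \<in> reach E r X"
  using assms unfolding reach_def by (auto intro: rtrancl_into_rtrancl)

lemma reach_least:
  assumes "r \<in> W" "\<And>a b. a \<in> W \<Longrightarrow> a \<in> X \<Longrightarrow> (a, b) \<in> E \<Longrightarrow> b \<in> W"
  shows "reach E r X \<subseteq> W"
proof
  fix v assume "v \<in> reach E r X"
  then have "(r, v) \<in> {(a, b) \<in> E. a \<in> X}\<^sup>*" by (simp add: reach_def)
  then show "v \<in> W" by (induction rule: rtrancl_induct) (use assms in auto)
qed

lemma reach_mono: "X \<subseteq> Y \<Longrightarrow> reach E r X \<subseteq> reach E r Y"
  by (rule reach_least) (auto intro: reach_step)

lemma reach_subset: "reach E r X \<subseteq> insert r (Range E)"
  by (rule reach_least) auto

lemma finite_reach [simp]: "finite E \<Longrightarrow> finite (reach E r X)"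
  by (rule finite_subset[OF reach_subset]) (simp add: finite_Range)

text \<open>Because \<open>I\<close> is already reached, a vertex reached for the first time through
  \<open>u\<close> lies outside \<open>I\<close> and differs from \<open>u\<close>; it is therefore
  not expanded in turn.\<close>

lemma reach_insert:
  assumes "I \<subseteq> reach E r I" "u \<in> reach E r I"
  shows "reach E r (insert u I) = reach E r I \<union> E `` {u}"
proof
  show "reach E r (insert u I) \<subseteq> reach E r I \<union> E `` {u}"
    by (rule reach_least) (use assms in \<open>auto intro: reach_step\<close>)
  show "reach E r I \<union> E `` {u} \<subseteq> reach E r (insert u I)"
    using reach_mono[of I "insert u I" E r] assms by (auto intro: reach_step)
qed

section \<open>The branching search\<close>

text \<open>A list instead of a set: its order is that in which \<open>scan\<close> meets the arcs
  and pushes their heads.\<close>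

definition fresh :: "('a \<times> 'a) list \<Rightarrow> 'a set \<Rightarrow> 'a \<Rightarrow> 'a list" where
  "fresh es V u = map snd (filter (\<lambda>(a, b). a = u \<and> b \<notin> V) es)"

lemma set_fresh: "set (fresh es V u) = set es `` {u} - V"
  by (force simp: fresh_def)

lemma distinct_fresh: "distinct es \<Longrightarrow> distinct (fresh es V u)"
  by (auto simp: fresh_def distinct_map intro!: inj_onI)

text \<open>
  The top of the stack is the end of the list. The guess \<open>c\<close> is consumed bitwise from its least
  significant bit; the flag \<open>f\<close> says that the top vertex is the only child of its parent and
  is expanded without consuming a bit.
\<close>

inductive accepts :: "(nat \<times> nat) list \<Rightarrow> nat \<Rightarrow> nat \<Rightarrow> nat set \<Rightarrow> nat list \<Rightarrow> nat \<Rightarrow> bool \<Rightarrow> bool"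
  for es :: "(nat \<times> nat) list" and k :: nat where
  goal: "k \<le> \<rho> + length S \<Longrightarrow> accepts es k c V S \<rho> f"
| leaf: "\<rho> + length S + 1 < k \<Longrightarrow> even c \<Longrightarrow> accepts es k (c div 2) V S (Suc \<rho>) False \<Longrightarrow>
    accepts es k c V (S @ [u]) \<rho> False"
| expand: "\<rho> + length S + 1 < k \<Longrightarrow> f \<or> odd c \<Longrightarrow> N = fresh es V u \<Longrightarrow>
    accepts es k (if f then c else c div 2) (V \<union> set N) (S @ N)
      (if N = [] then Suc \<rho> else \<rho>) (length N = 1) \<Longrightarrow>
    accepts es k c V (S @ [u]) \<rho> f"

text \<open>The premises of the three rules exclude each other, so a run is deterministic and can be
  unfolded in both directions. The program invariant \<open>searching\<close> needs this, since
  rejection must be preserved as well as acceptance.\<close>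

lemma accepts_goal_iff: "k \<le> \<rho> + length S \<Longrightarrow> accepts es k c V S \<rho> f \<longleftrightarrow> True"
  by (simp add: accepts.goal)

lemma accepts_Nil_iff: "accepts es k c V [] \<rho> f \<longleftrightarrow> k \<le> \<rho>"
  by (auto elim: accepts.cases intro: accepts.goal)

lemma accepts_leaf_iff:
  assumes "\<rho> + length S + 1 < k" "even c"
  shows "accepts es k c V (S @ [u]) \<rho> False \<longleftrightarrow> accepts es k (c div 2) V S (Suc \<rho>) False"
  using assms by (auto elim: accepts.cases intro: accepts.leaf)

lemma accepts_expand_iff:
  assumes "\<rho> + length S + 1 < k" "f \<or> odd c"
  shows "accepts es k c V (S @ [u]) \<rho> f \<longleftrightarrow>
    accepts es k (if f then c else c div 2) (V \<union> set (fresh es V u)) (S @ fresh es V u)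
      (if fresh es V u = [] then Suc \<rho> else \<rho>) (length (fresh es V u) = 1)"
proof
  assume "accepts es k c V (S @ [u]) \<rho> f"
  then show "accepts es k (if f then c else c div 2) (V \<union> set (fresh es V u)) (S @ fresh es V u)
      (if fresh es V u = [] then Suc \<rho> else \<rho>) (length (fresh es V u) = 1)"
    by cases (use assms in auto)
qed (use assms in \<open>blast intro: accepts.expand\<close>)

text \<open>\<open>I\<close> holds the inner vertices, \<open>R\<close> those declared leaves and
  \<open>S\<close> the undecided ones. Stopping at any moment with \<open>I\<close> as inner set
  yields \<open>length S + card R\<close> leaves, which explains the rule
  \<open>goal\<close>.\<close>

definition frontier :: "('a \<times> 'a) set \<Rightarrow> 'a \<Rightarrow> 'a set \<Rightarrow> 'a set \<Rightarrow> 'a list \<Rightarrow> 'a set \<Rightarrow> bool" where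
  "frontier E r I V S R \<longleftrightarrow>
     V = reach E r I \<and> I \<subseteq> V \<and> distinct S \<and> set S \<inter> R = {} \<and> set S \<union> R = V - I"

lemma frontier_root: "frontier E r {} {r} [r] {}"
proof -
  have "reach E r {} = {r}"
    using reach_least[of r "{r}" "{}" E] by auto
  then show ?thesis by (simp add: frontier_def)
qed

lemma frontier_leaf: "frontier E r I V (S @ [u]) R \<Longrightarrow> frontier E r I V S (insert u R)"
  by (auto simp: frontier_def)

lemma frontier_expand:
  assumes "frontier (set es) r I V (S @ [u]) R" "distinct es" "(u, u) \<notin> set es"
  shows "frontier (set es) r (insert u I) (V \<union> set (fresh es V u)) (S @ fresh es V u) R"
proof -
  have V: "V = reach (set es) r I" and I: "I \<subseteq> V" and u: "u \<in> V" "u \<notin> I" "u \<notin> set S" "u \<notin> R"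
    and S: "distinct S" "set S \<inter> R = {}" "insert u (set S \<union> R) = V - I"
    using assms(1) by (auto simp: frontier_def)
  have "reach (set es) r (insert u I) = V \<union> set (fresh es V u)"
    using reach_insert[of I "set es" r u] V I u by (auto simp: set_fresh)
  moreover have "set (fresh es V u) \<inter> V = {}" by (auto simp: set_fresh)
  moreover have "distinct (fresh es V u)" using assms(2) by (rule distinct_fresh)
  ultimately show ?thesis using I u S unfolding frontier_def by (auto 4 3)
qed

lemma finite_frontier:
  assumes "finite E" "frontier E r I V S R"
  shows "finite R"
  using assms finite_subset[of R "reach E r I"] unfolding frontier_def by auto

section \<open>Soundness: accepting runs yield inner sets\<close>

lemma accepts_sound:
  assumes "accepts es k c V S \<rho> f" "frontier (set es) r I V S R" "\<rho> = card R"
    "distinct es" "\<And>v. (v, v) \<notin> set es"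
  shows "\<exists>X. k \<le> card (reach (set es) r X - X)"
  using assms
proof (induction arbitrary: I R rule: accepts.induct)
  case (goal \<rho> S c V f)
  \<comment> \<open>The witness is the current inner set: \<open>S\<close> and \<open>R\<close>
    together are exactly the reached vertices outside \<open>I\<close>.\<close>
  then have "reach (set es) r I - I = set S \<union> R" "finite R" "card (set S) = length S"
    "set S \<inter> R = {}"
    using finite_frontier[OF _ goal.prems(1)] by (auto simp: frontier_def distinct_card)
  with goal.hyps goal.prems(2) have "k \<le> card (reach (set es) r I - I)"
    by (simp add: card_Un_disjoint)
  then show ?case ..
next
  case (leaf \<rho> S c V u)
  have "card (insert u R) = Suc (card R)"
    using finite_frontier[OF _ leaf.prems(1)] leaf.prems(1)
    by (subst card_insert_disjoint) (auto simp: frontier_def)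
  with leaf show ?case using leaf.IH[OF frontier_leaf[OF leaf.prems(1)]] by simp
next
  case (expand \<rho> S f c N V u)
  show ?case
  proof (cases "N = []")
    case True
    \<comment> \<open>A vertex without new out-neighbours leaves \<open>V\<close> unchanged, so it
      is moved to \<open>R\<close> instead of \<open>I\<close>; this matches the increment of
      \<open>\<rho>\<close> in the rule.\<close>
    have "card (insert u R) = Suc (card R)"
      using finite_frontier[OF _ expand.prems(1)] expand.prems(1)
      by (subst card_insert_disjoint) (auto simp: frontier_def)
    then show ?thesis using True expand.prems
        expand.IH[of I "insert u R"] frontier_leaf[OF expand.prems(1)] by simp
  next
    case False
    then show ?thesis using expand.prems expand.hyps
        expand.IH[of "insert u I" R] frontier_expand[OF expand.prems(1)] by simp
  qed
qed

section \<open>Completeness: extending partial solutions within the bit budget\<close>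

definition solution :: "('a \<times> 'a) set \<Rightarrow> 'a \<Rightarrow> nat \<Rightarrow> 'a set \<Rightarrow> 'a set \<Rightarrow> 'a set \<Rightarrow> bool" where
  "solution E r k I R X \<longleftrightarrow> I \<subseteq> X \<and> X \<inter> R = {} \<and> k \<le> card (reach E r X - X)"

text \<open>With nothing undecided, \<open>V - I\<close> is \<open>R\<close>, which \<open>X\<close>
  avoids. Hence arcs that leave \<open>X\<close> from within \<open>V\<close> start in
  \<open>I\<close> and stay in \<open>V\<close>, and the leaves of \<open>X\<close> are just
  \<open>R\<close>.\<close>

lemma no_solution_without_candidates:
  assumes "frontier E r I V [] R" "solution E r k I R X"
  shows "k \<le> card R"
proof -
  have "reach E r X \<subseteq> V"
    using assms by (intro reach_least) (auto simp: frontier_def solution_def intro: reach_step)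
  then have "reach E r X = V"
    using assms reach_mono[of I X E r] by (auto simp: frontier_def solution_def)
  then have "reach E r X - X = R"
    using assms by (auto simp: frontier_def solution_def)
  with assms show ?thesis by (simp add: solution_def)
qed

text \<open>
  Turning \<open>u\<close> into a leaf loses at most the leaf \<open>w\<close>, since everything else that \<open>u\<close> leads to
  is reached through \<open>I\<close> anyway.
\<close>

lemma solution_remove:
  assumes "finite E" "solution E r k I R X" "u \<in> reach E r I" "u \<notin> I" "u \<in> X"
    and W: "E `` {u} - reach E r I \<subseteq> W" "W \<inter> X = {}" "card W \<le> 1" "finite W" "u \<notin> R"
  shows "solution E r k I R (X - {u})"
proof -
  have IX: "I \<subseteq> X - {u}" using assms by (auto simp: solution_def)
  have "reach E r X \<subseteq> reach E r (X - {u}) \<union> W"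
  proof (rule reach_least)
    fix a b assume ab: "a \<in> reach E r (X - {u}) \<union> W" "a \<in> X" "(a, b) \<in> E"
    show "b \<in> reach E r (X - {u}) \<union> W"
    \<comment> \<open>Successors of \<open>u\<close> are reached through \<open>I\<close> or lie in
      \<open>W\<close>; members of \<open>W\<close> are not in \<open>X\<close>, so none of their
      arcs has to be followed.\<close>
    proof (cases "a = u")
      case True
      then show ?thesis using ab W reach_mono[OF IX, of E r] by auto
    next
      case False
      then show ?thesis using ab W by (auto intro: reach_step)
    qed
  qed auto
  moreover have u: "u \<in> reach E r (X - {u})" using assms(3) reach_mono[OF IX] by blast
  ultimately have sub: "insert u (reach E r X - X) - W \<subseteq> reach E r (X - {u}) - (X - {u})"
    by auto
  \<comment> \<open>The exchange balances: \<open>u\<close> is gained as a leaf, and at most the one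
    vertex of \<open>W\<close> is lost.\<close>
  have "k \<le> card (reach E r X - X)" using assms(2) by (simp add: solution_def)
  also have "\<dots> = card (insert u (reach E r X - X)) - 1"
    using assms by (subst card_insert_disjoint) auto
  also have "\<dots> \<le> card (insert u (reach E r X - X)) - card W" using W by simp
  also have "\<dots> \<le> card (insert u (reach E r X - X) - W)"
    by (rule diff_card_le_card_Diff) (use W in auto)
  also have "\<dots> \<le> card (reach E r (X - {u}) - (X - {u}))"
    using assms by (intro card_mono[OF _ sub]) simp
  finally show ?thesis using assms IX by (auto simp: solution_def)
qed

text \<open>Unvisited vertices plus stack height drive the induction; the exponent counts the bits
  left. A leaf decision lowers it by one because \<open>R\<close> counts twice, an expansion with
  two or more new vertices because the stack grows. A single child keeps the stack height. The
  second statement handles this case: its top vertex is forced, and its exponent is one less than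
  the first statement allows for the same stack, the bit being charged where the forced chain
  starts.\<close>

lemma accepts_complete_aux:
  assumes "distinct es" "\<And>v. (v, v) \<notin> set es"
  shows "frontier (set es) r I V S R \<Longrightarrow>
      card (insert r (Range (set es)) - V) + length S \<le> m \<Longrightarrow> solution (set es) r k I R X \<Longrightarrow>
      \<exists>c < 2 ^ (2 * k - 2 * card R - length S). accepts es k c V S (card R) False"
    and "frontier (set es) r I V (S @ [u]) R \<Longrightarrow>
      card (insert r (Range (set es)) - V) + length S + 1 \<le> m \<Longrightarrow> solution (set es) r k I R X \<Longrightarrow>
      (\<And>X. solution (set es) r k I R X \<Longrightarrow> u \<in> X) \<Longrightarrow>
      \<exists>c < 2 ^ (2 * k - 2 * card R - length S - 2). accepts es k c V (S @ [u]) (card R) True"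
proof (induction m arbitrary: I V S R X u)
  case 0
  {
    case 1
    then have "S = []" by simp
    with no_solution_without_candidates[of "set es" r I V R k X] 1 show ?case
      by (auto intro!: exI[of _ 0] simp: accepts_Nil_iff)
  next
    case 2
    then show ?case by simp
  }
next
  case (Suc m)
  have fin: "finite (insert r (Range (set es)))" by (simp add: finite_Range)
  have forced: "\<exists>c < 2 ^ (2 * k - 2 * card R - length S - 2). accepts es k c V (S @ [u]) (card R) True"
    if fr: "frontier (set es) r I V (S @ [u]) R"
      and m: "card (insert r (Range (set es)) - V) + length S + 1 \<le> Suc m"
      and X: "solution (set es) r k I R X"
      and u: "\<And>X. solution (set es) r k I R X \<Longrightarrow> u \<in> X" for I V S R X u
  proof (cases "k \<le> card R + length S + 1")
    case True
    then show ?thesis by (intro exI[of _ 0]) (simp add: accepts_goal_iff)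
  next
    case False
    define N where "N = fresh es V u"
    have V: "V = reach (set es) r I" and uV: "u \<in> V" "u \<notin> I" "u \<notin> R"
      using fr by (auto simp: frontier_def)
    have N: "set N = set es `` {u} - V" "distinct N"
      using assms by (auto simp: N_def set_fresh distinct_fresh)
    \<comment> \<open>If a solution avoided the only possible new neighbour of \<open>u\<close>, the
      exchange argument would remove \<open>u\<close> from it, although \<open>u\<close> lies in
      every solution.\<close>
    have remove: "set N \<inter> Y \<noteq> {}" if "length N \<le> 1" "solution (set es) r k I R Y" for Y
    proof
      assume "set N \<inter> Y = {}"
      then have "solution (set es) r k I R (Y - {u})"
        using that V uV u[of Y] N
        by (intro solution_remove[of _ _ _ _ _ _ _ "set N"])
           (auto simp flip: N(1) distinct_card[OF N(2)])
      from u[OF this] show False by simp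
    qed
    have fr': "frontier (set es) r (insert u I) (V \<union> set N) (S @ N) R"
      unfolding N_def using fr assms by (rule frontier_expand)
    \<comment> \<open>Since \<open>u\<close> belongs to every solution, promoting it to
      \<open>I\<close> excludes none.\<close>
    have sol': "solution (set es) r k (insert u I) R Y \<longleftrightarrow> solution (set es) r k I R Y" for Y
      using u[of Y] by (auto simp: solution_def)
    have "set N \<subseteq> insert r (Range (set es)) - V" using N by auto
    moreover have "insert r (Range (set es)) - (V \<union> set N) = (insert r (Range (set es)) - V) - set N"
      by blast
    moreover have "card (set N) = length N" using N(2) by (rule distinct_card)
    ultimately have "card (insert r (Range (set es)) - (V \<union> set N)) + length N
        = card (insert r (Range (set es)) - V)"
      using fin card_mono[of "insert r (Range (set es)) - V" "set N"]
      by (simp add: card_Diff_subset)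
    then have m': "card (insert r (Range (set es)) - (V \<union> set N)) + length (S @ N) \<le> m"
      using m by simp
    \<comment> \<open>An empty \<open>N\<close> would contradict \<open>remove\<close>, so a forced
      vertex always has a child.\<close>
    have "N \<noteq> []" using remove[OF _ X] by auto
    obtain c where "c < 2 ^ (2 * k - 2 * card R - length S - 2)"
      "accepts es k c (V \<union> set N) (S @ N) (card R) (length N = 1)"
    proof (cases "length N = 1")
      case True
      then obtain w where w: "N = [w]" by (auto simp: length_Suc_conv)
      \<comment> \<open>The only child is forced in turn, and the exponent is unchanged because the
        child takes the place of \<open>u\<close> on the stack.\<close>
      have "w \<in> Y" if "solution (set es) r k (insert u I) R Y" for Y
        using remove[of Y] that sol' w by auto
      then show ?thesis
        using Suc.IH(2)[of "insert u I" "V \<union> set N" S w R X] fr' m' X sol' w that by auto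
    next
      case False
      with \<open>N \<noteq> []\<close> have "2 \<le> length N" by (cases N; cases "tl N") auto
      obtain c where c: "c < 2 ^ (2 * k - 2 * card R - length (S @ N))"
        "accepts es k c (V \<union> set N) (S @ N) (card R) False"
        using Suc.IH(1)[OF fr' m'] X sol' by blast
      note c(1)
      \<comment> \<open>At least two new vertices make up for the 2 subtracted in the
        exponent.\<close>
      also have "(2::nat) ^ (2 * k - 2 * card R - length (S @ N)) \<le> 2 ^ (2 * k - 2 * card R - length S - 2)"
        using \<open>2 \<le> length N\<close> by (intro power_increasing) auto
      finally show ?thesis using that c(2) False by simp
    qed
    then show ?thesis
      using False \<open>N \<noteq> []\<close> accepts_expand_iff[of "card R" S k True c es V u]
      by (auto simp: N_def)
  qed
  {
    case 1
    show ?case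
    proof (cases "k \<le> card R + length S")
      case True
      then show ?thesis by (intro exI[of _ 0]) (simp add: accepts_goal_iff)
    next
      case False
      with no_solution_without_candidates[of "set es" r I V R k X] 1 have "S \<noteq> []" by auto
      then obtain T u where S: "S = T @ [u]" by (metis rev_exhaust)
      \<comment> \<open>As the goal is not reached, the subtractions below are not truncated and at
        least one bit is left.\<close>
      have lt: "card R + length T + 1 < k" using False S by simp
      then have exponent: "2 * k - 2 * card R - length S = Suc (2 * k - 2 * card R - length T - 2)"
        using S by simp
      show ?thesis
      \<comment> \<open>If some solution omits \<open>u\<close>, declaring \<open>u\<close> a leaf
        with bit 0 is safe; otherwise \<open>u\<close> is in every solution and
        \<open>forced\<close> applies after bit 1.\<close>
      proof (cases "\<exists>Y. solution (set es) r k I R Y \<and> u \<notin> Y")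
        case True
        then obtain Y where Y: "solution (set es) r k I (insert u R) Y"
          by (auto simp: solution_def)
        have fr: "frontier (set es) r I V T (insert u R)"
          using 1 S by (simp add: frontier_leaf)
        have card: "card (insert u R) = Suc (card R)"
          using finite_frontier[OF _ 1(1)] 1(1) S
          by (subst card_insert_disjoint) (auto simp: frontier_def)
        obtain c where c: "c < 2 ^ (2 * k - 2 * card (insert u R) - length T)"
          "accepts es k c V T (card (insert u R)) False"
          using Suc.IH(1)[OF fr _ Y] 1 S by auto
        then have "accepts es k (2 * c) V S (card R) False"
          using lt card accepts_leaf_iff[of "card R" T k "2 * c"] S by simp
        moreover have "2 * c < 2 ^ (2 * k - 2 * card R - length S)"
          using c(1) card exponent by (simp add: algebra_simps)
        ultimately show ?thesis by blast
      next
        case False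
        then obtain c where c: "c < 2 ^ (2 * k - 2 * card R - length T - 2)"
          "accepts es k c V (T @ [u]) (card R) True"
          using forced[of I V T u R X] 1 S by auto
        \<comment> \<open>Expanding on bit 1 and expanding under the flag reach the same state with
          the same remaining guess, so acceptance carries over.\<close>
        then have "accepts es k (2 * c + 1) V S (card R) False"
          using lt accepts_expand_iff[of "card R" T k True c es V u]
            accepts_expand_iff[of "card R" T k False "2 * c + 1" es V u] S by simp
        moreover have "2 * c + 1 < 2 ^ (2 * k - 2 * card R - length S)"
          using c(1) exponent by simp
        ultimately show ?thesis by blast
      qed
    qed
  next
    case 2
    then show ?case by (rule forced)
  }
qed

text \<open>The initial stack \<open>[r]\<close> already lowers the exponent to
  \<open>2 * k - 1\<close>. Rounding the range up to \<open>4 ^ k\<close> is harmless because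
  soundness holds for every guess.\<close>

theorem accepts_iff:
  assumes "distinct es" "\<And>v. (v, v) \<notin> set es"
  shows "(\<exists>c < 4 ^ k. accepts es k c {r} [r] 0 False) \<longleftrightarrow>
    (\<exists>X. k \<le> card (reach (set es) r X - X))"
proof
  assume "\<exists>c < 4 ^ k. accepts es k c {r} [r] 0 False"
  then show "\<exists>X. k \<le> card (reach (set es) r X - X)"
    using accepts_sound[OF _ frontier_root] assms by force
next
  assume "\<exists>X. k \<le> card (reach (set es) r X - X)"
  then obtain X where "solution (set es) r k {} {} X" by (auto simp: solution_def)
  from accepts_complete_aux(1)[OF assms frontier_root order_refl this]
  obtain c where "c < 2 ^ (2 * k - 1)" "accepts es k c {r} [r] 0 False" by auto
  moreover have "(2::nat) ^ (2 * k - 1) \<le> 2 ^ (2 * k)" by (intro power_increasing) auto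
  then have "(2::nat) ^ (2 * k - 1) \<le> 4 ^ k" by (simp add: power_mult)
  ultimately show "\<exists>c < 4 ^ k. accepts es k c {r} [r] 0 False" by (meson less_le_trans)
qed

section \<open>Out-branchings and sets of inner vertices\<close>

text \<open>The tree grows by one pendant vertex at a time. The vertex attached last meets a single
  arc, which drives the induction against cycles.\<close>

inductive arborescence :: "'a \<Rightarrow> 'a set \<Rightarrow> ('a \<times> 'a) set \<Rightarrow> bool" for r where
  root: "arborescence r {r} {}"
| grow: "arborescence r V A \<Longrightarrow> u \<in> V \<Longrightarrow> v \<notin> V \<Longrightarrow> arborescence r (insert v V) (insert (u, v) A)"

lemma arborescence_wellformed:
  assumes "arborescence r V A"
  shows "finite V \<and> finite A \<and> r \<in> V \<and> A \<subseteq> V \<times> V \<and> A \<inter> A\<inverse> = {}"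
  using assms by induction auto

lemma arborescence_Range:
  assumes "arborescence r V A"
  shows "Range A = V - {r}"
  using assms
proof induction
  case (grow V A u v)
  then show ?case using arborescence_wellformed[OF grow.hyps(1)] by auto
qed auto

lemma arborescence_reaches:
  assumes "arborescence r V A" "v \<in> V"
  shows "(r, v) \<in> A\<^sup>*"
  using assms
proof (induction arbitrary: v)
  case (grow V A u w)
  have mono: "A\<^sup>* \<subseteq> (insert (u, w) A)\<^sup>*" by (rule rtrancl_mono) auto
  then have "(r, u) \<in> (insert (u, w) A)\<^sup>*" using grow.IH[OF grow.hyps(2)] by auto
  then have "(r, w) \<in> (insert (u, w) A)\<^sup>*" by (rule rtrancl_into_rtrancl) simp
  with grow mono show ?case by auto
qed auto

text \<open>Attaching \<open>v\<close> below \<open>u\<close> costs at most the leaf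
  \<open>u\<close> and gains the leaf \<open>v\<close>, so the number of leaves never drops. This is
  applied first to the arcs leaving \<open>X\<close>, then to all arcs of the digraph.\<close>

lemma arborescence_extend:
  assumes "arborescence r V A" "A \<subseteq> F" "finite (F\<^sup>* `` {r})"
  shows "\<exists>A'. arborescence r (F\<^sup>* `` {r}) A' \<and> A' \<subseteq> F \<and> card (V - Domain A) \<le> card (F\<^sup>* `` {r} - Domain A')"
  using assms
proof (induction "card (F\<^sup>* `` {r} - V)" arbitrary: V A rule: less_induct)
  case less
  have "V \<subseteq> F\<^sup>* `` {r}"
    using arborescence_reaches[OF less.prems(1)] rtrancl_mono[OF less.prems(2)] by auto
  show ?case
  proof (cases "V = F\<^sup>* `` {r}")
    case True
    with less.prems show ?thesis by auto
  next
    case False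
    have r: "r \<in> V" and AV: "A \<subseteq> V \<times> V" and fin: "finite V"
      using arborescence_wellformed[OF less.prems(1)] by auto
    \<comment> \<open>If no arc of \<open>F\<close> left \<open>V\<close>, then \<open>V\<close>
      would be closed and contain everything reachable from \<open>r\<close>.\<close>
    have "\<exists>u v. (u, v) \<in> F \<and> u \<in> V \<and> v \<notin> V"
    proof (rule ccontr)
      assume closed: "\<nexists>u v. (u, v) \<in> F \<and> u \<in> V \<and> v \<notin> V"
      have "w \<in> V" if "(r, w) \<in> F\<^sup>*" for w
        using that by induction (use r closed in auto)
      with False \<open>V \<subseteq> _\<close> show False by auto
    qed
    then obtain u v where uv: "(u, v) \<in> F" "u \<in> V" "v \<notin> V" by auto
    then have v: "v \<in> F\<^sup>* `` {r}" using \<open>V \<subseteq> _\<close> by (auto intro: rtrancl_into_rtrancl)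
    have "insert v ((V - Domain A) - {u}) \<subseteq> insert v V - Domain (insert (u, v) A)"
      using AV uv by auto
    from card_mono[OF _ this] have "card (insert v ((V - Domain A) - {u})) \<le> card (insert v V - Domain (insert (u, v) A))"
      using fin by simp
    moreover have "card (V - Domain A) \<le> Suc (card ((V - Domain A) - {u}))"
      using diff_card_le_card_Diff[of "{u}" "V - Domain A"] by simp
    ultimately have "card (V - Domain A) \<le> card (insert v V - Domain (insert (u, v) A))"
      using fin uv by simp
    moreover have "F\<^sup>* `` {r} - insert v V \<subset> F\<^sup>* `` {r} - V" using v uv by auto
    then have "card (F\<^sup>* `` {r} - insert v V) < card (F\<^sup>* `` {r} - V)"
      using less.prems(3) by (intro psubset_card_mono) auto
    ultimately show ?thesis
      using less.hyps[of "insert v V" "insert (u, v) A"] less.prems uv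
      by (force intro: arborescence.grow)
  qed
qed

text \<open>A closed walk must enter \<open>v\<close> from \<open>u\<close> and return to
  \<open>u\<close>. Then the arcs just before and just after the one entering \<open>v\<close> both
  have head \<open>u\<close>; as heads are distinct, they coincide, which forces a length of at most
  2.\<close>

lemma closed_walk_no_pendant:
  assumes "distinct (map snd p)" "3 \<le> length p"
    and step: "\<And>i. i < length p \<Longrightarrow> fst (p ! (Suc i mod length p)) = snd (p ! i)"
    and pendant: "\<And>a. (v, a) \<in> set p \<Longrightarrow> a = u" "\<And>a. (a, v) \<in> set p \<Longrightarrow> a = u"
  shows "v \<notin> snd ` set p"
proof
  assume "v \<in> snd ` set p"
  then obtain i where i: "i < length p" "snd (p ! i) = v"
    by (auto simp: in_set_conv_nth)
  define l where "l = length p"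
  \<comment> \<open>\<open>j\<close> and \<open>h\<close> are the cyclic successor and predecessor
    of \<open>i\<close>; adding \<open>l\<close> before subtracting avoids truncation at
    \<open>i = 0\<close>.\<close>
  define j where "j = Suc i mod l"
  define h where "h = (i + l - 1) mod l"
  have l: "i < l" "3 \<le> l" using i assms(2) by (auto simp: l_def)
  then have jh: "j < l" "h < l" by (simp_all add: j_def h_def)
  have "Suc h mod l = Suc (i + l - 1) mod l" unfolding h_def by (rule mod_Suc_eq)
  moreover have "Suc (i + l - 1) = i + l" using l by linarith
  ultimately have "Suc h mod l = i" using l by simp
  moreover have "p ! i \<in> set p" "p ! j \<in> set p" using l jh by (auto simp: l_def)
  moreover have "fst (p ! j) = v" using step[of i] i by (simp add: j_def l_def)
  ultimately have "snd (p ! j) = u" "snd (p ! h) = u"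
    using pendant i step[of h] l jh by (metis l_def prod.collapse)+
  then have "j = h"
    using assms(1) jh by (auto simp: l_def distinct_conv_nth)
  then show False
    using l by (cases "Suc i < l"; cases i) (auto simp: j_def h_def mod_if split: if_splits)
qed

text \<open>Dropping the start of the vertex sequence of a walk leaves the list of arc heads, so a
  library cycle becomes a cyclic list of arcs with distinct heads.\<close>

lemma cycle_next:
  assumes "pre_digraph.cycle (with_proj G) p"
  shows "distinct (map snd p)"
    and "i < length p \<Longrightarrow> fst (p ! (Suc i mod length p)) = snd (p ! i)"
    and "set p \<subseteq> parcs G"
proof -
  obtain u where u: "pcas u p u" "distinct (tl (pawalk_verts u p))" "p \<noteq> []" "set p \<subseteq> parcs G"
    using assms by (auto simp: pre_digraph.cycle_def pre_digraph.awalk_def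
        cas_with_proj_eq awalk_verts_with_proj_eq)
  have verts: "pcas a p b \<Longrightarrow> pawalk_verts a p = a # map snd p" for a b
    by (induction p arbitrary: a) auto
  have adj: "pcas a p b \<Longrightarrow> Suc i < length p \<Longrightarrow> fst (p ! Suc i) = snd (p ! i)" for a b p
  proof (induction p arbitrary: a i)
    case (Cons e p)
    then show ?case by (cases i; cases p) auto
  qed simp
  have ends: "pcas a p b \<Longrightarrow> p \<noteq> [] \<Longrightarrow> fst (hd p) = a \<and> snd (last p) = b" for a b p
    by (induction p arbitrary: a) (auto split: if_splits)
  show "distinct (map snd p)" using u verts by auto
  show "set p \<subseteq> parcs G" by (rule u)
  show "fst (p ! (Suc i mod length p)) = snd (p ! i)" if "i < length p"
  proof (cases "Suc i < length p")
    case True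
    then show ?thesis using adj[OF u(1)] by simp
  next
    case False
    then have "Suc i = length p" using that by simp
    then show ?thesis using ends[OF u(1,3)] u(3) by (simp add: hd_conv_nth last_conv_nth flip: \<open>Suc i = _\<close>)
  qed
qed

text \<open>The vertex attached last is pendant, so it is not the head of an arc of the walk; it is
  not a tail either, because each tail is the head of the preceding arc. The walk thus lies in the
  smaller tree, down to the empty arc set.\<close>

lemma arborescence_no_cycle:
  assumes "arborescence r V A" "distinct (map snd p)" "3 \<le> length p" "set p \<subseteq> A \<union> A\<inverse>"
    "\<And>i. i < length p \<Longrightarrow> fst (p ! (Suc i mod length p)) = snd (p ! i)"
  shows False
  using assms
proof (induction arbitrary: p)
  case root
  then show ?case by auto
next
  case (grow V A u v)
  have AV: "A \<subseteq> V \<times> V" using arborescence_wellformed[OF grow.hyps(1)] by simp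
  have "v \<notin> snd ` set p"
    by (rule closed_walk_no_pendant[of p v u]) (use grow.prems AV \<open>v \<notin> V\<close> in auto)
  moreover have "v \<notin> fst ` set p"
  proof
    assume "v \<in> fst ` set p"
    then obtain j where j: "j < length p" "fst (p ! j) = v" by (auto simp: in_set_conv_nth)
    define i where "i = (j + length p - 1) mod length p"
    have "Suc i mod length p = Suc (j + length p - 1) mod length p"
      unfolding i_def by (rule mod_Suc_eq)
    moreover have "Suc (j + length p - 1) = j + length p" using j by linarith
    ultimately have "Suc i mod length p = j" using j by simp
    moreover have "i < length p" unfolding i_def using j by (intro mod_less_divisor) linarith
    ultimately have "snd (p ! i) = v" using grow.prems(4)[of i] j by simp
    with \<open>i < length p\<close> \<open>v \<notin> snd ` set p\<close> show False by force
  qed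
  ultimately have "set p \<subseteq> A \<union> A\<inverse>" using grow.prems(3) by force
  with grow.IH[of p] grow.prems show ?case by blast
qed

text \<open>Connectedness goes through the root: in the symmetric closure every vertex leads back to
  \<open>r\<close>, and \<open>r\<close> leads to every vertex.\<close>

lemma arborescence_out_tree:
  assumes "arborescence r V A"
  shows "out_tree (with_proj \<lparr>pverts = V, parcs = A\<rparr>)"
proof -
  let ?T = "\<lparr>pverts = V, parcs = A\<rparr>"
  have wf: "finite V" "finite A" "r \<in> V" "A \<subseteq> V \<times> V" "A \<inter> A\<inverse> = {}"
    using arborescence_wellformed[OF assms] by auto
  interpret T: pair_digraph ?T
    by unfold_locales (use wf in auto)
  have "digraph (with_proj ?T)" by unfold_locales
  moreover have "connected (with_proj ?T)"
    unfolding connected_def strongly_connected_def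
  proof (intro conjI ballI)
    show "verts (with_proj (mk_symmetric (with_proj ?T))) \<noteq> {}" using wf by auto
    interpret S: pair_wf_digraph "mk_symmetric (with_proj ?T)"
      using T.wellformed_mk_symmetric by simp
    have r: "r \<rightarrow>\<^sup>*\<^bsub>mk_symmetric (with_proj ?T)\<^esub> v" if "v \<in> V" for v
    proof -
      have "r \<rightarrow>\<^sup>*\<^bsub>with_proj ?T\<^esub> v"
        using arborescence_reaches[OF assms that] wf that
        by (simp add: T.reachable_conv)
      then show ?thesis by (rule T.reachable_mk_symmetricI)
    qed
    fix u v
    assume "u \<in> verts (with_proj (mk_symmetric (with_proj ?T)))"
      "v \<in> verts (with_proj (mk_symmetric (with_proj ?T)))"
    then have "u \<rightarrow>\<^sup>*\<^bsub>mk_symmetric (with_proj ?T)\<^esub> r" "r \<rightarrow>\<^sup>*\<^bsub>mk_symmetric (with_proj ?T)\<^esub> v"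
      using symmetric_reachable[OF symmetric_mk_symmetric r] r by auto
    then show "u \<rightarrow>\<^sup>*\<^bsub>mk_symmetric (with_proj ?T)\<^esub> v" by (rule S.reachable_trans)
  qed
  moreover have "\<not> (\<exists>p. pre_digraph.cycle (with_proj (mk_symmetric (with_proj ?T))) p \<and> 3 \<le> length p)"
  proof
    assume "\<exists>p. pre_digraph.cycle (with_proj (mk_symmetric (with_proj ?T))) p \<and> 3 \<le> length p"
    then obtain p where p: "pre_digraph.cycle (with_proj (mk_symmetric (with_proj ?T))) p" "3 \<le> length p"
      by auto
    have "set p \<subseteq> A \<union> A\<inverse>"
      using cycle_next(3)[OF p(1)] by (auto simp: parcs_mk_symmetric)
    from arborescence_no_cycle[OF assms cycle_next(1)[OF p(1)] p(2) this cycle_next(2)[OF p(1)]]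
    show False .
  qed
  moreover have "in_degree (with_proj ?T) v = 0 \<longleftrightarrow> v = r" if "v \<in> V" for v
  proof -
    have "in_degree (with_proj ?T) v = 0 \<longleftrightarrow> v \<notin> Range A"
      using wf by (auto simp: in_degree_def in_arcs_def Range_iff)
    then show ?thesis using arborescence_Range[OF assms] that by simp
  qed
  ultimately show ?thesis using wf by (auto simp: out_tree_def oriented_tree_def)
qed

text \<open>A directed cycle survives in the symmetric closure, where length 3 or more is forbidden.
  Length 1 would be a loop, and length 2 a pair of opposite arcs.\<close>

lemma oriented_tree_acyclic:
  assumes "oriented_tree T"
  shows "acyclic (arcs_ends T)"
proof -
  interpret T: digraph T using assms by (simp add: oriented_tree_def)
  interpret S: pair_digraph "mk_symmetric T" by (rule T.digraph_mk_symmetric)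
  \<comment> \<open>Arcs of \<open>T\<close> may have any type; \<open>H\<close> replaces them by
    their pairs of ends, which makes its cycles comparable with those of
    \<open>mk_symmetric T\<close>.\<close>
  define H where "H = \<lparr>pverts = verts T, parcs = arcs_ends T\<rparr>"
  interpret H: pair_wf_digraph H
    by unfold_locales (auto simp: H_def arcs_ends_conv)
  show ?thesis
  proof (rule acyclicI, rule allI, rule notI)
    fix x assume "(x, x) \<in> (arcs_ends T)\<^sup>+"
    then have "x \<rightarrow>\<^sup>+\<^bsub>with_proj H\<^esub> x" by (simp add: H_def)
    then obtain p where "H.awalk x p x" "p \<noteq> []"
      using H.reachable1_awalk[of x x] by (auto simp: H_def)
    then have "H.closed_w p" by (auto simp: H.closed_w_def)
    from H.closed_w_imp_cycle[OF this] obtain q where q: "H.cycle q" by auto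
    have "subgraph (with_proj H) (with_proj (mk_symmetric T))"
      unfolding subgraph_def using H.wf_digraph S.wf_digraph
      by (auto simp: H_def arcs_ends_conv parcs_mk_symmetric compatible_def)
    from S.subgraph_cycle[OF this] q have "S.cycle q" by simp
    then have "length q < 3" using assms by (auto simp: oriented_tree_def not_le)
    moreover have "q \<noteq> []" using q by (auto simp: H.cycle_def)
    moreover have "length q \<noteq> 1"
    proof
      assume "length q = 1"
      then obtain e where "q = [e]" by (auto simp: length_Suc_conv)
      with cycle_next[OF q] have "fst e = snd e" "e \<in> arcs_ends T" by (auto simp: H_def)
      then show False using T.no_loops by (auto simp: arcs_ends_conv)
    qed
    ultimately have "length q = 2" by (cases q; cases "tl q") auto
    then obtain e e' where e: "q = [e, e']" by (auto simp: length_Suc_conv numeral_2_eq_2)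
    with cycle_next(2)[OF q, of 0] cycle_next(2)[OF q, of 1] cycle_next(3)[OF q]
    have "e' = (snd e, fst e)" "e \<in> arcs_ends T" "e' \<in> arcs_ends T"
      by (auto simp: H_def prod_eq_iff)
    then show False
      using assms by (cases e) (auto simp: oriented_tree_def)
  qed
qed

text \<open>Acyclicity and finiteness make the arc relation well-founded. Going backwards along arcs
  therefore ends in a vertex of in-degree zero, which is the unique root.\<close>

lemma out_tree_reaches:
  assumes "out_tree T"
  obtains r where "r \<in> verts T" "verts T \<subseteq> (arcs_ends T)\<^sup>* `` {r}"
proof -
  interpret T: digraph T using assms by (simp add: out_tree_def oriented_tree_def)
  obtain r where r: "r \<in> verts T" "\<And>v. v \<in> verts T \<Longrightarrow> in_degree T v = 0 \<Longrightarrow> v = r"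
    using assms by (auto simp: out_tree_def)
  have "finite (arcs_ends T)" by (simp add: arcs_ends_def)
  then have "wf (arcs_ends T)"
    using oriented_tree_acyclic assms by (auto simp: out_tree_def intro: finite_acyclic_wf)
  then have "v \<in> verts T \<longrightarrow> (r, v) \<in> (arcs_ends T)\<^sup>*" for v
  proof (induction v rule: wf_induct_rule)
    case (less v)
    show ?case
    proof
      assume v: "v \<in> verts T"
      show "(r, v) \<in> (arcs_ends T)\<^sup>*"
      proof (cases "in_degree T v = 0")
        case True
        then show ?thesis using r v by auto
      next
        case False
        then obtain e where "e \<in> arcs T" "head T e = v"
          by (auto simp: in_degree_def in_arcs_def)
        then have "(tail T e, v) \<in> arcs_ends T" "tail T e \<in> verts T" by (auto simp: arcs_ends_conv)
        with less show ?thesis by (blast intro: rtrancl_into_rtrancl)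
      qed
    qed
  qed
  with r show thesis using that[of r] by blast
qed

theorem has_leafy_out_branching_iff:
  assumes D: "pair_digraph D" "strongly_connected (with_proj D)"
  shows "has_leafy_out_branching (with_proj D) k \<longleftrightarrow>
    (\<exists>r \<in> pverts D. \<exists>X. k \<le> card (reach (parcs D) r X - X))"
proof -
  interpret D: pair_digraph D by (rule D)
  show ?thesis
  proof
    assume "has_leafy_out_branching (with_proj D) k"
    then obtain T where T: "out_tree T" "subgraph T (with_proj D)" "verts T = pverts D"
      "k \<le> card (leaves T)"
      by (auto simp: has_leafy_out_branching_def out_branching_def)
    interpret T: digraph T using T(1) by (simp add: out_tree_def oriented_tree_def)
    obtain r where r: "r \<in> verts T" "verts T \<subseteq> (arcs_ends T)\<^sup>* `` {r}"
      by (rule out_tree_reaches[OF T(1)])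
    \<comment> \<open>With the tails of \<open>T\<close> as inner vertices every arc of
      \<open>T\<close> may be followed, and the leaves of \<open>T\<close> stay outside
      \<open>X\<close>.\<close>
    define X where "X = Domain (arcs_ends T)"
    have "arcs_ends T \<subseteq> parcs D" using arcs_ends_mono[OF T(2)] by simp
    then have "arcs_ends T \<subseteq> {(a, b) \<in> parcs D. a \<in> X}" by (auto simp: X_def)
    from rtrancl_mono[OF this] r have "verts T \<subseteq> reach (parcs D) r X"
      by (auto simp: reach_def)
    moreover have "leaves T \<inter> X = {}"
      by (auto simp: leaves_def X_def out_degree_def out_arcs_def arcs_ends_conv)
    ultimately have "leaves T \<subseteq> reach (parcs D) r X - X" by (auto simp: leaves_def)
    with T(4) have "k \<le> card (reach (parcs D) r X - X)"
      using card_mono[of "reach (parcs D) r X - X" "leaves T"] by (simp add: D.pair_finite_arcs)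
    with r T(3) show "\<exists>r \<in> pverts D. \<exists>X. k \<le> card (reach (parcs D) r X - X)" by auto
  next
    assume "\<exists>r \<in> pverts D. \<exists>X. k \<le> card (reach (parcs D) r X - X)"
    then obtain r X where r: "r \<in> pverts D" and X: "k \<le> card (reach (parcs D) r X - X)" by auto
    let ?F = "{(a, b) \<in> parcs D. a \<in> X}"
    have F: "?F\<^sup>* `` {r} = reach (parcs D) r X" by (simp add: reach_def)
    \<comment> \<open>Strong connectivity makes every vertex a possible root.\<close>
    have all: "(parcs D)\<^sup>* `` {r} = pverts D"
    proof
      show "(parcs D)\<^sup>* `` {r} \<subseteq> pverts D"
      proof
        fix v assume "v \<in> (parcs D)\<^sup>* `` {r}"
        then have "(r, v) \<in> (parcs D)\<^sup>*" by simp
        then show "v \<in> pverts D" by induction (use r D.in_arcsD2 in auto)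
      qed
      show "pverts D \<subseteq> (parcs D)\<^sup>* `` {r}"
        using D(2) r by (auto simp: strongly_connected_def D.reachable_conv)
    qed
    obtain A where A: "arborescence r (reach (parcs D) r X) A" "A \<subseteq> ?F"
      using arborescence_extend[OF arborescence.root[of r], of ?F] F
      by (auto simp: D.pair_finite_arcs)
    \<comment> \<open>Arcs of \<open>A\<close> start in \<open>X\<close>, so every reached vertex
      outside \<open>X\<close> is a leaf of \<open>A\<close>.\<close>
    have "reach (parcs D) r X - X \<subseteq> reach (parcs D) r X - Domain A" using A(2) by auto
    from card_mono[OF _ this] have leaves: "k \<le> card (reach (parcs D) r X - Domain A)"
      using X by (simp add: D.pair_finite_arcs)
    have "A \<subseteq> parcs D" using A(2) by auto
    \<comment> \<open>The second extension uses all arcs and collects the remaining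
      vertices.\<close>
    from arborescence_extend[OF A(1) this] obtain B where
      B: "arborescence r (pverts D) B" "B \<subseteq> parcs D" "k \<le> card (pverts D - Domain B)"
      using leaves by (auto simp: all D.pair_finite_verts)
    let ?T = "with_proj \<lparr>pverts = pverts D, parcs = B\<rparr>"
    have "finite B" using B(2) D.pair_finite_arcs by (rule finite_subset)
    then have "leaves ?T = pverts D - Domain B"
      by (auto simp: leaves_def out_degree_def out_arcs_def)
    moreover have "out_branching ?T (with_proj D)"
    proof -
      have "wf_digraph ?T" using B(2) by unfold_locales (auto dest!: subsetD intro: D.in_arcsD1 D.in_arcsD2)
      then show ?thesis
        using arborescence_out_tree[OF B(1)] B(2) D.wf_digraph
        by (auto simp: out_branching_def subgraph_def compatible_def)
    qed
    ultimately show "has_leafy_out_branching (with_proj D) k"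
      using B(3) by (auto simp: has_leafy_out_branching_def)
  qed
qed

section \<open>Time-bounded correctness of programs\<close>

text \<open>Total correctness with an upper bound on the time; exhibiting one halting run suffices
  since \<open>exec\<close> is deterministic.\<close>

definition runs :: "store \<Rightarrow> com \<Rightarrow> nat \<Rightarrow> (store \<Rightarrow> bool) \<Rightarrow> bool" where
  "runs s c T Q \<longleftrightarrow> (\<exists>t s'. exec c s t s' \<and> t \<le> T \<and> Q s')"

lemma runs_mono: "runs s c T Q \<Longrightarrow> T \<le> T' \<Longrightarrow> (\<And>s'. Q s' \<Longrightarrow> Q' s') \<Longrightarrow> runs s c T' Q'"
  unfolding runs_def by (meson order_trans)

lemma runs_Skip: "1 \<le> T \<Longrightarrow> Q s \<Longrightarrow> runs s Skip T Q"
  unfolding runs_def by (meson exec.Skip)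

lemma runs_Write:
  "1 + acost i + acost a \<le> T \<Longrightarrow> Q (s(x := (s x)(aval i s := aval a s))) \<Longrightarrow> runs s (Write x i a) T Q"
  unfolding runs_def by (meson exec.Write)

lemma runs_Seq:
  "T1 + T2 \<le> T \<Longrightarrow> runs s c1 T1 (\<lambda>s'. runs s' c2 T2 Q) \<Longrightarrow> runs s (Seq c1 c2) T Q"
  unfolding runs_def by (meson exec.Seq add_mono order_trans)

text \<open>The remaining budget is computed by subtraction, so straight-line code can be executed
  symbolically without guessing intermediate times.\<close>

lemma runs_Write_Seq:
  "1 + acost i + acost a \<le> T \<Longrightarrow>
    runs (s(x := (s x)(aval i s := aval a s))) c (T - (1 + acost i + acost a)) Q \<Longrightarrow>
    runs s (Seq (Write x i a) c) T Q"
  by (rule runs_Seq[of "1 + acost i + acost a"]) (auto intro: runs_Write)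

lemma runs_If:
  assumes "1 + bcost b \<le> T" "bval b s \<Longrightarrow> runs s c1 (T - (1 + bcost b)) Q"
    "\<not> bval b s \<Longrightarrow> runs s c2 (T - (1 + bcost b)) Q"
  shows "runs s (If b c1 c2) T Q"
proof (cases "bval b s")
  case True
  with assms(2) obtain t s' where "exec c1 s t s'" "t \<le> T - (1 + bcost b)" "Q s'"
    by (auto simp: runs_def)
  with assms(1) exec.IfTrue[OF True, of c1 t s' c2] show ?thesis unfolding runs_def by fastforce
next
  case False
  with assms(3) obtain t s' where "exec c2 s t s'" "t \<le> T - (1 + bcost b)" "Q s'"
    by (auto simp: runs_def)
  with assms(1) exec.IfFalse[OF False, of c2 t s' c1] show ?thesis unfolding runs_def by fastforce
qed

text \<open>The variant \<open>f\<close> allows at most \<open>N\<close> rounds;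
  \<open>Suc N\<close> also pays for the last, failing test.\<close>

lemma runs_While:
  fixes f :: "store \<Rightarrow> nat"
  assumes "I s" "f s \<le> N"
    and body: "\<And>s. I s \<Longrightarrow> bval b s \<Longrightarrow> runs s c T (\<lambda>s'. I s' \<and> f s' < f s)"
    and post: "\<And>s. I s \<Longrightarrow> \<not> bval b s \<Longrightarrow> Q s"
  shows "runs s (While b c) (Suc N * (1 + bcost b + T)) Q"
  using assms(1,2)
proof (induction N arbitrary: s rule: less_induct)
  case (less N)
  show ?case
  proof (cases "bval b s")
    case True
    from body[OF less.prems(1) True] obtain t s' where
      t: "exec c s t s'" "t \<le> T" "I s'" "f s' < f s" by (auto simp: runs_def)
    then have "f s' < N" using less.prems(2) by simp
    from less.IH[OF this t(3) order_refl] obtain t' s'' where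
      t': "exec (While b c) s' t' s''" "t' \<le> Suc (f s') * (1 + bcost b + T)" "Q s''"
      by (auto simp: runs_def)
    have "Suc (f s') * (1 + bcost b + T) \<le> N * (1 + bcost b + T)"
      using \<open>f s' < N\<close> by (intro mult_le_mono1) simp
    then have "1 + bcost b + t + t' \<le> Suc N * (1 + bcost b + T)" using t(2) t'(2) by simp
    with exec.WhileTrue[OF True t(1) t'(1)] t'(3) show ?thesis unfolding runs_def by blast
  next
    case False
    with exec.WhileFalse[OF False, of c] post[OF less.prems(1) False] show ?thesis
      unfolding runs_def by fastforce
  qed
qed

section \<open>Derived constructs and counting loops\<close>

abbreviation var :: "string \<Rightarrow> aexp" where
  "var x \<equiv> Read x (Const 0)"

abbreviation assign :: "string \<Rightarrow> aexp \<Rightarrow> com" where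
  "assign x a \<equiv> Write x (Const 0) a"

abbreviation incr :: "string \<Rightarrow> com" where
  "incr x \<equiv> assign x (Add (var x) (Const 1))"

primrec block :: "com list \<Rightarrow> com" where
  "block [] = Skip"
| "block (c # cs) = Seq c (block cs)"

abbreviation count_to :: "string \<Rightarrow> string \<Rightarrow> com \<Rightarrow> com" where
  "count_to x y c \<equiv> Seq (assign x (Const 0)) (While (Less (var x) (var y)) (Seq c (incr x)))"


text \<open>Guard and increment cost 6 units each, the initialisation 3. The counter value is a
  parameter of \<open>I\<close>, and \<open>stable\<close> makes \<open>I\<close> itself independent
  of the array \<open>x\<close>, which the loop overwrites.\<close>

lemma runs_count_to:
  assumes time: "3 + Suc N * (12 + T) \<le> T'"
    and init: "I 0 s"
    and stable: "\<And>i s v. I i s \<Longrightarrow> I i (s(x := v))"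
    and bound: "\<And>i s. I i s \<Longrightarrow> s y 0 = N"
    and body: "\<And>i s. i < N \<Longrightarrow> s x 0 = i \<Longrightarrow> I i s \<Longrightarrow>
      runs s c T (\<lambda>s'. s' x 0 = i \<and> I (Suc i) s')"
    and post: "\<And>s. I N s \<Longrightarrow> Q s"
  shows "runs s (count_to x y c) T' Q"
proof -
  have loop: "runs (s(x := (s x)(aval (Const 0) s := aval (Const 0) s)))
      (While (Less (var x) (var y)) (Seq c (incr x)))
      (Suc N * (1 + bcost (Less (var x) (var y)) + (T + 6))) Q"
  proof (rule runs_While[where I = "\<lambda>s. s x 0 \<le> N \<and> I (s x 0) s" and f = "\<lambda>s. N - s x 0"])
    fix s
    assume inv: "s x 0 \<le> N \<and> I (s x 0) s"
    { assume "bval (Less (var x) (var y)) s"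
      then have lt: "s x 0 < N" using bound inv by auto
      show "runs s (Seq c (incr x)) (T + 6) (\<lambda>s'. (s' x 0 \<le> N \<and> I (s' x 0) s') \<and> N - s' x 0 < N - s x 0)"
      proof (rule runs_Seq[OF order_refl], rule runs_mono)
        show "runs s c T (\<lambda>s'. s' x 0 = s x 0 \<and> I (Suc (s x 0)) s')"
          using body lt inv by blast
        fix s' assume s': "s' x 0 = s x 0 \<and> I (Suc (s x 0)) s'"
        show "runs s' (incr x) 6 (\<lambda>s'. (s' x 0 \<le> N \<and> I (s' x 0) s') \<and> N - s' x 0 < N - s x 0)"
          by (rule runs_Write) (use s' lt stable in auto)
      qed simp
    next
      assume "\<not> bval (Less (var x) (var y)) s"
      then have "s x 0 = N" using bound inv by auto
      with inv post show "Q s" by auto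
    }
  qed (use init stable in auto)
  show ?thesis
  proof (rule runs_Write_Seq)
    show "runs (s(x := (s x)(aval (Const 0) s := aval (Const 0) s)))
      (While (Less (var x) (var y)) (Seq c (incr x))) (T' - (1 + acost (Const 0) + acost (Const 0))) Q"
      by (rule runs_mono[OF loop]) (use time in \<open>simp_all add: algebra_simps\<close>)
  qed (use time in simp)
qed

text \<open>A frame condition on whole arrays.\<close>

definition agree_off :: "string set \<Rightarrow> store \<Rightarrow> store \<Rightarrow> bool" where
  "agree_off A s s' \<longleftrightarrow> (\<forall>x. x \<notin> A \<longrightarrow> s' x = s x)"

lemma agree_off_refl: "agree_off A s s"
  by (simp add: agree_off_def)

abbreviation aeq :: "aexp \<Rightarrow> aexp \<Rightarrow> bexp" where
  "aeq a b \<equiv> Conj (Neg (Less a b)) (Neg (Less b a))"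

section \<open>The program\<close>

text \<open>Halving without division or shifts: \<open>h\<close> counts up to half of
  \<open>c\<close>. This takes time linear in \<open>c\<close>, which is affordable because guesses
  stay below \<open>4 ^ k\<close>.\<close>

definition next_bit :: com where
  "next_bit = block [assign ''h'' (Const 0),
     While (Less (Add (Add (var ''h'') (var ''h'')) (Const 1)) (var ''c'')) (incr ''h''),
     assign ''b'' (Sub (var ''c'') (Add (var ''h'') (var ''h''))),
     assign ''c'' (var ''h'')]"

lemma runs_next_bit:
  assumes "s ''c'' 0 \<le> G"
    and "\<And>s'. agree_off {''h'', ''b'', ''c''} s s' \<Longrightarrow> s' ''b'' 0 = s ''c'' 0 mod 2 \<Longrightarrow>
      s' ''c'' 0 = s ''c'' 0 div 2 \<Longrightarrow> Q s'"
  shows "runs s next_bit (50 * (G + 1)) Q"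
  unfolding next_bit_def block.simps
  apply (rule runs_Write_Seq, simp)
  apply (rule runs_Seq[OF _ runs_While[where N = G and T = 6 and f = "\<lambda>s'. s ''c'' 0 - s' ''h'' 0" and
        I = "\<lambda>s'. agree_off {''h'', ''b''} s s' \<and> (s' ''h'' 0 = 0 \<or> 2 * s' ''h'' 0 \<le> s ''c'' 0)"],
        where ?T2.0 = 20])
  subgoal by simp
  subgoal by (simp add: agree_off_def)
  subgoal using assms(1) by simp
  subgoal for s'
    by (rule runs_Write) (auto simp: agree_off_def)
  subgoal for s'
  proof -
    assume inv: "agree_off {''h'', ''b''} s s' \<and> (s' ''h'' 0 = 0 \<or> 2 * s' ''h'' 0 \<le> s ''c'' 0)"
      and exit: "\<not> bval (Less (Add (Add (var ''h'') (var ''h'')) (Const 1)) (var ''c'')) s'"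
    have c: "s' ''c'' 0 = s ''c'' 0" using inv by (simp add: agree_off_def)
    \<comment> \<open>The failed test gives \<open>c <= 2 h + 1\<close> and the invariant
      \<open>2 h <= c\<close>, which leaves two values.\<close>
    then have "s ''c'' 0 = 2 * s' ''h'' 0 \<or> s ''c'' 0 = 2 * s' ''h'' 0 + 1"
      using inv exit by auto
    then have h: "s' ''h'' 0 = s ''c'' 0 div 2" "s ''c'' 0 - 2 * s' ''h'' 0 = s ''c'' 0 mod 2"
      by auto
    show ?thesis
      by (intro runs_Write_Seq runs_Skip assms(2); use inv c h in \<open>simp add: agree_off_def mult_2\<close>)
  qed
  done

definition scan :: com where
  "scan = count_to ''j'' ''m''
     (If (Conj (aeq (Read ''tail'' (var ''j'')) (var ''u''))
            (Less (Read ''vis'' (Read ''head'' (var ''j''))) (Const 1)))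
        (block [Write ''vis'' (Read ''head'' (var ''j'')) (Const 1),
           Write ''st'' (var ''sp'') (Read ''head'' (var ''j'')),
           incr ''sp''])
        Skip)"

definition input :: "nat \<Rightarrow> (nat \<times> nat) list \<Rightarrow> nat \<Rightarrow> store \<Rightarrow> bool" where
  "input n es k s \<longleftrightarrow> s ''n'' 0 = n \<and> s ''m'' 0 = length es \<and> s ''k'' 0 = k \<and>
     (\<forall>i < length es. s ''tail'' i = fst (es ! i) \<and> s ''head'' i = snd (es ! i))"

text \<open>Entries of \<open>st\<close> from index \<open>sp\<close> on are unconstrained, since
  popping only lowers \<open>sp\<close>.\<close>

definition stores :: "nat \<Rightarrow> nat set \<Rightarrow> nat list \<Rightarrow> store \<Rightarrow> bool" where
  "stores n V S s \<longleftrightarrow> (\<forall>v < n. s ''vis'' v = of_bool (v \<in> V)) \<and>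
     s ''sp'' 0 = length S \<and> (\<forall>i < length S. s ''st'' i = S ! i)"

text \<open>The program marks vertices while scanning and so tests each head against the enlarged
  visited set, whereas \<open>fresh\<close> tests against \<open>V\<close> only. As no arc is listed
  twice, both tests agree.\<close>

lemma fresh_take_Suc:
  assumes "i < length es" "distinct es"
  shows "fresh (take (Suc i) es) V u = fresh (take i es) V u @
    (if fst (es ! i) = u \<and> snd (es ! i) \<notin> V \<union> set (fresh (take i es) V u) then [snd (es ! i)] else [])"
proof -
  have "es ! i \<notin> set (take i es)"
    using assms by (auto simp: in_set_conv_nth nth_eq_iff_index_eq)
  then have "fst (es ! i) = u \<Longrightarrow> snd (es ! i) \<notin> set (fresh (take i es) V u)"
    by (auto simp: set_fresh)
  then show ?thesis
    using assms(1) by (auto simp: fresh_def take_Suc_conv_app_nth case_prod_beta)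
qed

lemma runs_scan:
  assumes inp: "input n es k s" "distinct es" "snd ` set es \<subseteq> {..<n}"
    and st: "stores n V S s" "s ''u'' 0 = u"
    and post: "\<And>s'. agree_off {''j'', ''vis'', ''st'', ''sp''} s s' \<Longrightarrow>
      stores n (V \<union> set (fresh es V u)) (S @ fresh es V u) s' \<Longrightarrow> Q s'"
  shows "runs s scan (80 * (length es + 1)) Q"
  unfolding scan_def block.simps
proof (rule runs_count_to[where N = "length es" and T = 50 and I = "\<lambda>i s'.
    agree_off {''j'', ''vis'', ''st'', ''sp''} s s' \<and>
    stores n (V \<union> set (fresh (take i es) V u)) (S @ fresh (take i es) V u) s'"])
  fix i s'
  assume i: "i < length es" "s' ''j'' 0 = i"
    and I: "agree_off {''j'', ''vis'', ''st'', ''sp''} s s' \<and>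
      stores n (V \<union> set (fresh (take i es) V u)) (S @ fresh (take i es) V u) s'"
  have h: "snd (es ! i) < n" using subsetD[OF inp(3) imageI[OF nth_mem[OF i(1)]]] by simp
  define W where "W = V \<union> set (fresh (take i es) V u)"
  define F where "F = S @ fresh (take i es) V u"
  define P where "P \<longleftrightarrow> fst (es ! i) = u \<and> snd (es ! i) \<notin> W"
  have I': "agree_off {''j'', ''vis'', ''st'', ''sp''} s s'" "stores n W F s'"
    using I by (auto simp: W_def F_def)
  have vals: "s' ''tail'' i = fst (es ! i)" "s' ''head'' i = snd (es ! i)" "s' ''u'' 0 = u"
    "s' ''vis'' (snd (es ! i)) = of_bool (snd (es ! i) \<in> W)" "s' ''sp'' 0 = length F"
    using i I' h inp(1) st(2) by (simp_all add: agree_off_def input_def stores_def)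
  have goal: "V \<union> set (fresh (take (Suc i) es) V u) = (if P then insert (snd (es ! i)) W else W)"
    "S @ fresh (take (Suc i) es) V u = (if P then F @ [snd (es ! i)] else F)"
    unfolding fresh_take_Suc[OF i(1) inp(2)] by (auto simp: P_def W_def F_def)
  show "runs s' (If (Conj (aeq (Read ''tail'' (var ''j'')) (var ''u''))
            (Less (Read ''vis'' (Read ''head'' (var ''j''))) (Const 1)))
        (Seq (Write ''vis'' (Read ''head'' (var ''j'')) (Const 1))
           (Seq (Write ''st'' (var ''sp'') (Read ''head'' (var ''j'')))
           (Seq (incr ''sp'') Skip))) Skip) 50
     (\<lambda>s'. s' ''j'' 0 = i \<and> agree_off {''j'', ''vis'', ''st'', ''sp''} s s' \<and>
      stores n (V \<union> set (fresh (take (Suc i) es) V u)) (S @ fresh (take (Suc i) es) V u) s')"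
    unfolding goal
  proof (rule runs_If)
    assume "bval (Conj (aeq (Read ''tail'' (var ''j'')) (var ''u''))
            (Less (Read ''vis'' (Read ''head'' (var ''j''))) (Const 1))) s'"
    then have "P" using vals i by (simp add: P_def not_less)
    then show "runs s' (Seq (Write ''vis'' (Read ''head'' (var ''j'')) (Const 1))
           (Seq (Write ''st'' (var ''sp'') (Read ''head'' (var ''j'')))
           (Seq (incr ''sp'') Skip))) (50 - (1 + bcost (Conj (aeq (Read ''tail'' (var ''j'')) (var ''u''))
            (Less (Read ''vis'' (Read ''head'' (var ''j''))) (Const 1)))))
      (\<lambda>s'. s' ''j'' 0 = i \<and> agree_off {''j'', ''vis'', ''st'', ''sp''} s s' \<and>
        stores n (if P then insert (snd (es ! i)) W else W) (if P then F @ [snd (es ! i)] else F) s')"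
      using I' vals i
      by (intro runs_Write_Seq runs_Skip) (simp_all add: agree_off_def stores_def nth_append less_Suc_eq)
  next
    assume "\<not> bval (Conj (aeq (Read ''tail'' (var ''j'')) (var ''u''))
            (Less (Read ''vis'' (Read ''head'' (var ''j''))) (Const 1))) s'"
    then have "\<not> P" using vals i by (auto simp: P_def)
    then show "runs s' Skip (50 - (1 + bcost (Conj (aeq (Read ''tail'' (var ''j'')) (var ''u''))
            (Less (Read ''vis'' (Read ''head'' (var ''j''))) (Const 1)))))
      (\<lambda>s'. s' ''j'' 0 = i \<and> agree_off {''j'', ''vis'', ''st'', ''sp''} s s' \<and>
        stores n (if P then insert (snd (es ! i)) W else W) (if P then F @ [snd (es ! i)] else F) s')"
      using I' i by (intro runs_Skip) simp_all
  qed simp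
next
  show "agree_off {''j'', ''vis'', ''st'', ''sp''} s s \<and>
    stores n (V \<union> set (fresh (take 0 es) V u)) (S @ fresh (take 0 es) V u) s"
    using st by (simp add: agree_off_refl fresh_def)
next
  fix s' assume "agree_off {''j'', ''vis'', ''st'', ''sp''} s s' \<and>
      stores n (V \<union> set (fresh (take (length es) es) V u)) (S @ fresh (take (length es) es) V u) s'"
  then show "Q s'" using post by simp
next
  fix i s' v assume "agree_off {''j'', ''vis'', ''st'', ''sp''} s s' \<and>
      stores n (V \<union> set (fresh (take i es) V u)) (S @ fresh (take i es) V u) s'"
  then show "agree_off {''j'', ''vis'', ''st'', ''sp''} s (s'(''j'' := v)) \<and>
      stores n (V \<union> set (fresh (take i es) V u)) (S @ fresh (take i es) V u) (s'(''j'' := v))"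
    by (simp add: agree_off_def stores_def)
next
  fix i s' assume "agree_off {''j'', ''vis'', ''st'', ''sp''} s s' \<and>
      stores n (V \<union> set (fresh (take i es) V u)) (S @ fresh (take i es) V u) s'"
  then show "s' ''m'' 0 = length es" using inp(1) by (simp add: agree_off_def input_def)
qed simp


text \<open>\<open>t\<close> keeps the stack height before the scan; comparing it with
  \<open>sp\<close> tells whether no, one or several vertices were pushed.\<close>

definition expand_top :: com where
  "expand_top = block [assign ''t'' (var ''sp''), scan, assign ''f'' (Const 0),
     If (Less (var ''t'') (var ''sp''))
       (If (Less (Add (var ''t'') (Const 1)) (var ''sp'')) Skip (assign ''f'' (Const 1)))
       (incr ''red'')]"

lemma runs_expand_top:
  assumes inp: "input n es k s" "distinct es" "snd ` set es \<subseteq> {..<n}"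
    and st: "stores n V S s" "s ''u'' 0 = u"
    and post: "\<And>s'. agree_off {''j'', ''vis'', ''st'', ''sp'', ''t'', ''f'', ''red''} s s' \<Longrightarrow>
      stores n (V \<union> set (fresh es V u)) (S @ fresh es V u) s' \<Longrightarrow>
      s' ''f'' 0 = of_bool (length (fresh es V u) = 1) \<Longrightarrow>
      s' ''red'' 0 = (if fresh es V u = [] then Suc (s ''red'' 0) else s ''red'' 0) \<Longrightarrow> Q s'"
  shows "runs s expand_top (120 * (length es + 1)) Q"
  unfolding expand_top_def block.simps
proof (rule runs_Write_Seq)
  define N where "N = fresh es V u"
  let ?s = "s(''t'' := (s ''t'')(aval (Const 0) s := aval (var ''sp'') s))"
  have t: "?s ''t'' 0 = length S" using st by (simp add: stores_def)
  have st': "stores n V S ?s" "?s ''u'' 0 = u" "input n es k ?s"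
    using st inp by (simp_all add: stores_def input_def)
  let ?rest = "Seq (assign ''f'' (Const 0)) (Seq (If (Less (var ''t'') (var ''sp''))
       (If (Less (Add (var ''t'') (Const 1)) (var ''sp'')) Skip (assign ''f'' (Const 1)))
       (incr ''red'')) Skip)"
  have rest: "runs s' ?rest 30 Q"
    if ag: "agree_off {''j'', ''vis'', ''st'', ''sp''} ?s s'" and s': "stores n (V \<union> set N) (S @ N) s'" for s'
  proof -
    have vals: "s' ''t'' 0 = length S" "s' ''sp'' 0 = length S + length N" "s' ''red'' 0 = s ''red'' 0"
      using ag s' t by (simp_all add: agree_off_def stores_def)
    consider "N = []" | "length N = 1" | "2 \<le> length N" by (cases N; cases "tl N") auto
    then show ?thesis
    proof cases
      case 1
      show ?thesis
        by (intro runs_Write_Seq runs_Seq[where ?T1.0 = 20 and ?T2.0 = 1] runs_If runs_Write runs_Skip post;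
            use ag s' vals 1 in \<open>simp add: agree_off_def stores_def flip: N_def\<close>)
    next
      case 2
      then have "N \<noteq> []" by auto
      show ?thesis
        by (intro runs_Write_Seq runs_Seq[where ?T1.0 = 20 and ?T2.0 = 1] runs_If runs_Write runs_Skip post;
            use ag s' vals 2 \<open>N \<noteq> []\<close> in \<open>simp add: agree_off_def stores_def flip: N_def\<close>)
    next
      case 3
      then have "N \<noteq> []" by auto
      show ?thesis
        by (intro runs_Write_Seq runs_Seq[where ?T1.0 = 20 and ?T2.0 = 1] runs_If runs_Write runs_Skip post;
            use ag s' vals 3 \<open>N \<noteq> []\<close> in \<open>simp add: agree_off_def stores_def flip: N_def\<close>)
    qed
  qed
  show "runs ?s (Seq scan ?rest) (120 * (length es + 1) - (1 + acost (Const 0) + acost (var ''sp''))) Q"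
  proof (rule runs_Seq)
    show "runs ?s scan (80 * (length es + 1)) (\<lambda>s'. runs s' ?rest 30 Q)"
      by (rule runs_scan[OF st'(3) inp(2,3) st'(1,2)]) (rule rest[unfolded N_def])
  qed simp
qed simp

definition search_step :: com where
  "search_step = block [assign ''sp'' (Sub (var ''sp'') (Const 1)),
     assign ''u'' (Read ''st'' (var ''sp'')),
     If (Less (Const 0) (var ''f'')) (assign ''b'' (Const 1)) next_bit,
     If (Less (Const 0) (var ''b'')) expand_top (incr ''red'')]"

abbreviation scratch :: "string set" where
  "scratch \<equiv> {''j'', ''vis'', ''st'', ''sp'', ''t'', ''f'', ''red'', ''u'', ''b'', ''h'', ''c''}"

text \<open>\<open>acc\<close> is the verdict that the search, started on the initial frontier, has to reach.\<close>

definition searching :: "nat \<Rightarrow> (nat \<times> nat) list \<Rightarrow> nat \<Rightarrow> nat \<Rightarrow> bool \<Rightarrow> store \<Rightarrow> bool" where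
  "searching n es k G acc s \<longleftrightarrow> (\<exists>V S f. stores n V S s \<and> set S \<subseteq> V \<and> s ''f'' 0 = of_bool f \<and>
     s ''c'' 0 \<le> G \<and> (accepts es k (s ''c'' 0) V S (s ''red'' 0) f \<longleftrightarrow> acc))"

text \<open>Every step of the search pops one vertex, and each vertex is pushed at most once.\<close>

definition pending :: "nat \<Rightarrow> store \<Rightarrow> nat" where
  "pending n s = card {v. v < n \<and> s ''vis'' v = 0} + s ''sp'' 0"

lemma pending_stores:
  assumes "stores n V S s"
  shows "pending n s = card ({..<n} - V) + length S"
proof -
  have "{v. v < n \<and> s ''vis'' v = 0} = {..<n} - V"
    using assms by (auto simp: stores_def)
  then show ?thesis using assms by (simp add: pending_def stores_def)
qed

lemma runs_search_step:
  assumes inp: "input n es k s" "distinct es" "snd ` set es \<subseteq> {..<n}"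
    and inv: "searching n es k G acc s"
    and run: "0 < s ''sp'' 0" "s ''red'' 0 + s ''sp'' 0 < k"
  shows "runs s search_step (200 * (G + length es + 2))
    (\<lambda>s'. agree_off scratch s s' \<and> searching n es k G acc s' \<and> pending n s' < pending n s)"
    (is "runs s _ _ ?Q")
proof -
  obtain V S' f where S': "stores n V S' s" "set S' \<subseteq> V" and f: "s ''f'' 0 = of_bool f" and
    c: "s ''c'' 0 \<le> G" and acc: "accepts es k (s ''c'' 0) V S' (s ''red'' 0) f \<longleftrightarrow> acc"
    using inv by (auto simp: searching_def)
  obtain S u where S: "S' = S @ [u]"
    using S'(1) run(1) by (cases S' rule: rev_cases) (auto simp: stores_def)
  let ?c = "if f then s ''c'' 0 else s ''c'' 0 div 2"
  define s1 where "s1 = s(''sp'' := (s ''sp'')(0 := length S), ''u'' := (s ''u'')(0 := u))"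
  have lt: "s ''red'' 0 + length S + 1 < k" using S'(1) S run(2) by (simp add: stores_def)
  have "?c \<le> G" using c by auto
  have s1: "stores n V S s1"
    using S' S by (auto simp: stores_def s1_def nth_append split: if_splits)
  have pending: "pending n s = card ({..<n} - V) + length S + 1"
    using pending_stores[OF S'(1)] S by simp
  have leaf: "runs s2 (incr ''red'') (120 * (length es + 1)) ?Q"
    if ag: "agree_off {''h'', ''b'', ''c''} s1 s2" and "s2 ''b'' 0 = 0" "\<not> f" "even (s ''c'' 0)"
      "s2 ''c'' 0 = ?c" for s2
  proof -
    let ?s = "s2(''red'' := (s2 ''red'')(aval (Const 0) s2 := aval (Add (var ''red'') (Const 1)) s2))"
    have st: "stores n V S ?s" using s1 ag by (simp add: stores_def agree_off_def)
    have vals: "?s ''c'' 0 = s ''c'' 0 div 2" "?s ''red'' 0 = Suc (s ''red'' 0)" "?s ''f'' 0 = 0"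
      using ag that f by (simp_all add: agree_off_def s1_def)
    have "searching n es k G acc ?s"
      unfolding searching_def
      by (intro exI[of _ V] exI[of _ S] exI[of _ False])
        (use st vals acc accepts_leaf_iff[OF lt, of "s ''c'' 0" es V u] that S S' \<open>?c \<le> G\<close> in auto)
    moreover have "agree_off scratch s ?s"
      using ag by (simp add: agree_off_def s1_def)
    ultimately show ?thesis
      using pending pending_stores[OF st] by (intro runs_Write) auto
  qed
  have expand: "runs s2 expand_top (120 * (length es + 1)) ?Q"
    if ag: "agree_off {''h'', ''b'', ''c''} s1 s2" and odd: "f \<or> odd (s ''c'' 0)" and "s2 ''c'' 0 = ?c" for s2
  proof (rule runs_expand_top[OF _ inp(2,3)])
    show "input n es k s2" "stores n V S s2" "s2 ''u'' 0 = u"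
      using ag inp(1) s1 by (simp_all add: agree_off_def input_def stores_def s1_def)
    fix s3
    assume ag': "agree_off {''j'', ''vis'', ''st'', ''sp'', ''t'', ''f'', ''red''} s2 s3"
      and st: "stores n (V \<union> set (fresh es V u)) (S @ fresh es V u) s3"
      and f3: "s3 ''f'' 0 = of_bool (length (fresh es V u) = 1)"
      and red: "s3 ''red'' 0 = (if fresh es V u = [] then Suc (s2 ''red'' 0) else s2 ''red'' 0)"
    have "s3 ''c'' 0 = ?c" "s2 ''red'' 0 = s ''red'' 0"
      using ag ag' that by (simp_all add: agree_off_def s1_def)
    then have "searching n es k G acc s3"
      unfolding searching_def
      by (intro exI[of _ "V \<union> set (fresh es V u)"] exI[of _ "S @ fresh es V u"]
            exI[of _ "length (fresh es V u) = 1"])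
        (use st f3 red acc accepts_expand_iff[OF lt odd, of es V u] S S' \<open>?c \<le> G\<close> in auto)
    moreover have "agree_off scratch s s3"
      using ag ag' by (simp add: agree_off_def s1_def)
    \<comment> \<open>New vertices only move from the unvisited ones to the stack, so the pop of
      \<open>u\<close> is the net decrease of \<open>pending\<close>.\<close>
    moreover have "card ({..<n} - (V \<union> set (fresh es V u))) + length (fresh es V u) = card ({..<n} - V)"
    proof -
      have sub: "set (fresh es V u) \<subseteq> {..<n} - V" using inp(3) by (force simp: set_fresh)
      have "{..<n} - (V \<union> set (fresh es V u)) = ({..<n} - V) - set (fresh es V u)" by blast
      moreover have "card (set (fresh es V u)) = length (fresh es V u)"
        using distinct_fresh[OF inp(2)] by (rule distinct_card)
      ultimately show ?thesis
        using card_mono[OF _ sub] card_Diff_subset[OF _ sub] by simp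
    qed
    ultimately show "?Q s3" using pending pending_stores[OF st] by simp
  qed
  let ?branch = "If (Less (Const 0) (var ''b'')) expand_top (incr ''red'')"
  have branch: "runs s2 (Seq ?branch Skip) (140 * (length es + 1)) ?Q"
    if ag: "agree_off {''h'', ''b'', ''c''} s1 s2" and b: "s2 ''b'' 0 = (if f then 1 else s ''c'' 0 mod 2)"
      and c2: "s2 ''c'' 0 = ?c" for s2
  proof (rule runs_Seq[where ?T1.0 = "139 * (length es + 1)" and ?T2.0 = 1])
    show "runs s2 ?branch (139 * (length es + 1)) (\<lambda>s'. runs s' Skip 1 ?Q)"
    proof (rule runs_If)
      assume "bval (Less (Const 0) (var ''b'')) s2"
      then have "f \<or> odd (s ''c'' 0)" using b by (auto simp: odd_iff_mod_2_eq_one split: if_splits)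
      show "runs s2 expand_top (139 * (length es + 1) - (1 + bcost (Less (Const 0) (var ''b'')))) (\<lambda>s'. runs s' Skip 1 ?Q)"
        by (rule runs_mono[OF expand[OF ag \<open>f \<or> odd (s ''c'' 0)\<close> c2]]) (auto intro: runs_Skip)
    next
      assume "\<not> bval (Less (Const 0) (var ''b'')) s2"
      then have "s2 ''b'' 0 = 0" "\<not> f" "even (s ''c'' 0)" using b by (auto split: if_splits)
      show "runs s2 (incr ''red'') (139 * (length es + 1) - (1 + bcost (Less (Const 0) (var ''b'')))) (\<lambda>s'. runs s' Skip 1 ?Q)"
        by (rule runs_mono[OF leaf[OF ag \<open>s2 ''b'' 0 = 0\<close> \<open>\<not> f\<close> \<open>even (s ''c'' 0)\<close> c2]])
          (auto intro: runs_Skip)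
    qed simp
  qed simp
  have s1_vals: "s1 ''f'' 0 = of_bool f" "s1 ''c'' 0 = s ''c'' 0"
    using f by (simp_all add: s1_def)
  have main: "runs s1 (Seq (If (Less (Const 0) (var ''f'')) (assign ''b'' (Const 1)) next_bit)
      (Seq ?branch Skip)) (60 * (G + 1) + 140 * (length es + 1)) ?Q"
  proof (rule runs_Seq[OF order_refl], rule runs_If)
    assume "bval (Less (Const 0) (var ''f'')) s1"
    then have f by (simp add: s1_vals)
    show "runs s1 (assign ''b'' (Const 1)) (60 * (G + 1) - (1 + bcost (Less (Const 0) (var ''f''))))
        (\<lambda>s'. runs s' (Seq ?branch Skip) (140 * (length es + 1)) ?Q)"
      by (intro runs_Write branch; use \<open>f\<close> s1_vals in \<open>simp add: agree_off_def\<close>)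
  next
    assume "\<not> bval (Less (Const 0) (var ''f'')) s1"
    then have "\<not> f" by (simp add: s1_vals)
    have "runs s1 next_bit (50 * (G + 1)) (\<lambda>s'. runs s' (Seq ?branch Skip) (140 * (length es + 1)) ?Q)"
      by (intro runs_next_bit branch; use \<open>\<not> f\<close> s1_vals c in \<open>simp\<close>)
    then show "runs s1 next_bit (60 * (G + 1) - (1 + bcost (Less (Const 0) (var ''f''))))
        (\<lambda>s'. runs s' (Seq ?branch Skip) (140 * (length es + 1)) ?Q)"
      by (rule runs_mono) auto
  qed simp
  have "s(''sp'' := (s ''sp'')(0 := s ''sp'' 0 - 1),
      ''u'' := (s ''u'')(0 := s ''st'' (s ''sp'' 0 - 1))) = s1"
    using S'(1) S by (simp add: stores_def s1_def)
  with main show ?thesis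
    unfolding search_step_def block.simps
    by (intro runs_Write_Seq) (auto intro: runs_mono)
qed


definition search :: com where
  "search = While (Conj (Less (Const 0) (var ''sp'')) (Less (Add (var ''red'') (var ''sp'')) (var ''k''))) search_step"

text \<open>The loop ends on an empty stack or once \<open>red + sp\<close> reaches
  \<open>k\<close>. Comparing \<open>k\<close> with \<open>red + sp\<close> gives the verdict in
  both cases, since \<open>sp\<close> is 0 in the first.\<close>

lemma runs_search:
  assumes inp: "input n es k s" "distinct es" "snd ` set es \<subseteq> {..<n}"
    and inv: "searching n es k G acc s" "pending n s \<le> n"
    and post: "\<And>s'. agree_off scratch s s' \<Longrightarrow> k \<le> s' ''red'' 0 + s' ''sp'' 0 \<longleftrightarrow> acc \<Longrightarrow> Q s'"
  shows "runs s search (Suc n * (220 * (G + length es + 2))) Q"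
  unfolding search_def
proof (rule runs_mono)
  let ?b = "Conj (Less (Const 0) (var ''sp'')) (Less (Add (var ''red'') (var ''sp'')) (var ''k''))"
  show "runs s (While ?b search_step) (Suc n * (1 + bcost ?b + 200 * (G + length es + 2))) Q"
  proof (rule runs_While[where I = "\<lambda>s'. agree_off scratch s s' \<and> searching n es k G acc s'"
        and f = "pending n"])
    fix s' assume I: "agree_off scratch s s' \<and> searching n es k G acc s'"
    then have inp': "input n es k s'" using inp(1) by (simp add: agree_off_def input_def)
    { assume "bval ?b s'"
      then have "0 < s' ''sp'' 0" "s' ''red'' 0 + s' ''sp'' 0 < k"
        using inp' by (simp_all add: input_def)
      note step = runs_search_step[OF inp' inp(2,3) conjunct2[OF I] this]
      show "runs s' search_step (200 * (G + length es + 2))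
          (\<lambda>s''. (agree_off scratch s s'' \<and> searching n es k G acc s'') \<and> pending n s'' < pending n s')"
        by (rule runs_mono[OF step order_refl]) (use I in \<open>simp add: agree_off_def\<close>)
    next
      assume nb: "\<not> bval ?b s'"
      obtain V S f where S: "stores n V S s'"
        and acc: "accepts es k (s' ''c'' 0) V S (s' ''red'' 0) f \<longleftrightarrow> acc"
        using I by (auto simp: searching_def)
      have "k \<le> s' ''red'' 0 + s' ''sp'' 0 \<longleftrightarrow> acc"
      proof (cases "S = []")
        case True
        then show ?thesis using acc S by (simp add: accepts_Nil_iff stores_def)
      next
        case False
        then have "k \<le> s' ''red'' 0 + length S"
          using nb inp' S by (auto simp: stores_def input_def not_less)
        then show ?thesis using acc S by (simp add: accepts_goal_iff stores_def)
      qed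
      with post I show "Q s'" by blast
    }
  qed (use inv in \<open>simp_all add: agree_off_refl\<close>)
  show "Suc n * (1 + bcost ?b + 200 * (G + length es + 2)) \<le> Suc n * (220 * (G + length es + 2))"
    by (intro mult_le_mono2) simp
qed

text \<open>Marks of an earlier search have to be erased, whereas \<open>out\<close> is never reset
  and so collects the disjunction over all searches.\<close>

definition try_root :: com where
  "try_root = block [
     count_to ''v'' ''n'' (Write ''vis'' (var ''v'') (Const 0)),
     Write ''vis'' (var ''r'') (Const 1),
     assign ''st'' (var ''r''), assign ''sp'' (Const 1),
     assign ''red'' (Const 0), assign ''f'' (Const 0), assign ''c'' (var ''g''),
     search,
     If (Less (Add (var ''red'') (var ''sp'')) (var ''k'')) Skip (assign ''out'' (Const 1))]"

lemma runs_try_root: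
  assumes inp: "input n es k s" "distinct es" "snd ` set es \<subseteq> {..<n}"
    and r: "r < n" "s ''r'' 0 = r" and c: "c \<le> G" "s ''g'' 0 = c"
    and post: "\<And>s'. agree_off (scratch \<union> {''v'', ''out''}) s s' \<Longrightarrow>
      s' ''out'' 0 = (if accepts es k c {r} [r] 0 False then 1 else s ''out'' 0) \<Longrightarrow> Q s'"
  shows "runs s try_root (Suc n * (300 * (G + length es + 2))) Q"
proof -
  let ?final = "Seq (If (Less (Add (var ''red'') (var ''sp'')) (var ''k'')) Skip (assign ''out'' (Const 1))) Skip"
  let ?tail = "Seq (Write ''vis'' (var ''r'') (Const 1)) (Seq (assign ''st'' (var ''r''))
     (Seq (assign ''sp'' (Const 1)) (Seq (assign ''red'' (Const 0)) (Seq (assign ''f'' (Const 0))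
     (Seq (assign ''c'' (var ''g'')) (Seq search ?final))))))"
  let ?acc = "accepts es k c {r} [r] 0 False"
  have final: "runs s2 ?final 30 Q"
    if ag: "agree_off (insert ''v'' scratch) s s2" and acc: "k \<le> s2 ''red'' 0 + s2 ''sp'' 0 \<longleftrightarrow> ?acc" for s2
  proof -
    have k: "s2 ''k'' 0 = k" "s2 ''out'' 0 = s ''out'' 0"
      using ag inp(1) by (simp_all add: agree_off_def input_def)
    show ?thesis
      by (intro runs_Seq[where ?T1.0 = 20 and ?T2.0 = 1] runs_If runs_Write runs_Skip post;
          use ag k acc in \<open>simp add: agree_off_def not_less\<close>)
  qed
  define L where "L = Suc n * (220 * (G + length es + 2))"
  have search: "runs s1 (Seq search ?final) (L + 30) Q"
    if ag: "agree_off (insert ''v'' scratch) s s1" and st: "stores n {r} [r] s1"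
      and z: "s1 ''red'' 0 = 0" "s1 ''f'' 0 = 0" "s1 ''c'' 0 = c" for s1
    unfolding L_def
  proof (rule runs_Seq[OF order_refl], rule runs_search[OF _ inp(2,3)])
    show "input n es k s1" using ag inp(1) by (simp add: agree_off_def input_def)
    show "searching n es k G ?acc s1"
      unfolding searching_def
      by (intro exI[of _ "{r}"] exI[of _ "[r]"] exI[of _ False]) (use st z c in simp)
    \<comment> \<open>Initially \<open>n - 1\<close> vertices are unvisited and one is on the
      stack.\<close>
    have "card ({..<n} - {r}) = n - 1" using r by simp
    then show "pending n s1 \<le> n" using pending_stores[OF st] r by simp
    fix s2 assume "agree_off scratch s1 s2" "k \<le> s2 ''red'' 0 + s2 ''sp'' 0 \<longleftrightarrow> ?acc"
    then show "runs s2 ?final 30 Q" using ag by (intro final) (simp_all add: agree_off_def)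
  qed
  have tail: "runs s1 ?tail (L + 60) Q"
    if ag: "agree_off {''v'', ''vis''} s s1" and vis: "\<forall>v < n. s1 ''vis'' v = 0" for s1
  proof -
    have vals: "s1 ''r'' 0 = r" "s1 ''g'' 0 = c"
      using ag r c by (simp_all add: agree_off_def)
    show ?thesis
      by ((rule runs_Write_Seq, (simp; fail))+, rule runs_mono[OF search])
        (use ag vis vals in \<open>simp_all add: agree_off_def stores_def\<close>)
  qed
  show ?thesis
    unfolding try_root_def block.simps
  proof (rule runs_Seq)
    show "runs s (count_to ''v'' ''n'' (Write ''vis'' (var ''v'') (Const 0))) (3 + Suc n * 16)
        (\<lambda>s1. runs s1 ?tail (L + 60) Q)"
    proof (rule runs_count_to[where N = n and T = 4 and
          I = "\<lambda>i s1. agree_off {''v'', ''vis''} s s1 \<and> (\<forall>v < i. s1 ''vis'' v = 0)"])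
      fix i s1 assume "s1 ''v'' 0 = i" "agree_off {''v'', ''vis''} s s1 \<and> (\<forall>v < i. s1 ''vis'' v = 0)"
      then show "runs s1 (Write ''vis'' (var ''v'') (Const 0)) 4 (\<lambda>s'. s' ''v'' 0 = i \<and>
          agree_off {''v'', ''vis''} s s' \<and> (\<forall>v < Suc i. s' ''vis'' v = 0))"
        by (intro runs_Write) (simp_all add: agree_off_def less_Suc_eq)
    next
      fix i s1 assume "agree_off {''v'', ''vis''} s s1 \<and> (\<forall>v < i. s1 ''vis'' v = 0)"
      then show "s1 ''n'' 0 = n" using inp(1) by (simp add: agree_off_def input_def)
    next
      fix s1 assume "agree_off {''v'', ''vis''} s s1 \<and> (\<forall>v < n. s1 ''vis'' v = 0)"
      then show "runs s1 ?tail (L + 60) Q" using tail by blast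
    qed (simp_all add: agree_off_def)
  qed (simp add: L_def algebra_simps)
qed

text \<open>Two doublings per round produce \<open>4 ^ k\<close>, as the machine cannot
  multiply.\<close>

definition solve :: com where
  "solve = block [
     assign ''p'' (Const 1),
     count_to ''i'' ''k'' (block [assign ''p'' (Add (var ''p'') (var ''p'')), assign ''p'' (Add (var ''p'') (var ''p''))]),
     count_to ''g'' ''p'' (count_to ''r'' ''n'' try_root)]"

lemma runs_solve:
  assumes inp: "input n es k s" "distinct es" "snd ` set es \<subseteq> {..<n}"
    and "s ''out'' 0 = 0"
  shows "runs s solve (500 * (Suc (4 ^ k) * Suc n * Suc n * (4 ^ k + length es + 2)))
    (\<lambda>s'. s' ''out'' 0 = of_bool (\<exists>c < 4 ^ k. \<exists>r < n. accepts es k c {r} [r] 0 False))"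
    (is "runs _ _ _ ?Q")
proof -
  let ?W = "scratch \<union> {''v'', ''out'', ''p'', ''i'', ''g'', ''r''}"
  let ?acc = "\<lambda>c r. accepts es k c {r} [r] 0 False"
  let ?G = "4 ^ k :: nat"
  let ?L = "Suc n * (300 * (?G + length es + 2))"
  define M where "M = ?G + length es + 2"
  have roots: "runs s1 (count_to ''r'' ''n'' try_root) (3 + Suc n * (12 + ?L))
      (\<lambda>s2. s2 ''g'' 0 = c \<and> agree_off ?W s s2 \<and> s2 ''p'' 0 = ?G \<and>
        s2 ''out'' 0 = of_bool (\<exists>c' < Suc c. \<exists>r < n. ?acc c' r))"
    if s1: "agree_off ?W s s1" "s1 ''g'' 0 = c" "s1 ''p'' 0 = ?G"
      "s1 ''out'' 0 = of_bool (\<exists>c' < c. \<exists>r < n. ?acc c' r)" and c: "c < ?G" for s1 c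
  \<comment> \<open>Midway, \<open>out\<close> accounts for all roots under earlier guesses and for
    the roots below \<open>i\<close> under the current one.\<close>
  proof (rule runs_count_to[where N = n and T = ?L and I = "\<lambda>i s2. s2 ''g'' 0 = c \<and>
      agree_off ?W s s2 \<and> s2 ''p'' 0 = ?G \<and>
      s2 ''out'' 0 = of_bool ((\<exists>c' < c. \<exists>r < n. ?acc c' r) \<or> (\<exists>r < i. ?acc c r))"])
    fix i s2
    assume i: "i < n" "s2 ''r'' 0 = i" and I: "s2 ''g'' 0 = c \<and>
      agree_off ?W s s2 \<and> s2 ''p'' 0 = ?G \<and>
      s2 ''out'' 0 = of_bool ((\<exists>c' < c. \<exists>r < n. ?acc c' r) \<or> (\<exists>r < i. ?acc c r))"
    show "runs s2 try_root ?L (\<lambda>s3. s3 ''r'' 0 = i \<and> s3 ''g'' 0 = c \<and>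
      agree_off ?W s s3 \<and> s3 ''p'' 0 = ?G \<and>
      s3 ''out'' 0 = of_bool ((\<exists>c' < c. \<exists>r < n. ?acc c' r) \<or> (\<exists>r < Suc i. ?acc c r)))"
    proof (rule runs_try_root[where r = i and c = c and n = n and k = k])
      show "input n es k s2" using I inp(1) by (simp add: agree_off_def input_def)
      fix s3
      assume ag: "agree_off (scratch \<union> {''v'', ''out''}) s2 s3"
        and out: "s3 ''out'' 0 = (if ?acc c i then 1 else s2 ''out'' 0)"
      have "agree_off ?W s s3" using I ag by (simp add: agree_off_def)
      moreover have "s3 ''r'' 0 = i" "s3 ''g'' 0 = c" "s3 ''p'' 0 = ?G"
        using I ag i by (simp_all add: agree_off_def)
      moreover have "s3 ''out'' 0 = of_bool ((\<exists>c' < c. \<exists>r < n. ?acc c' r) \<or> (\<exists>r < Suc i. ?acc c r))"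
        using out I by (auto simp: less_Suc_eq)
      ultimately show "s3 ''r'' 0 = i \<and> s3 ''g'' 0 = c \<and> agree_off ?W s s3 \<and> s3 ''p'' 0 = ?G \<and>
        s3 ''out'' 0 = of_bool ((\<exists>c' < c. \<exists>r < n. ?acc c' r) \<or> (\<exists>r < Suc i. ?acc c r))" by simp
    qed (use inp(2,3) i I c in simp_all)
  next
    fix i s2 assume "s2 ''g'' 0 = c \<and> agree_off ?W s s2 \<and> s2 ''p'' 0 = ?G \<and>
      s2 ''out'' 0 = of_bool ((\<exists>c' < c. \<exists>r < n. ?acc c' r) \<or> (\<exists>r < i. ?acc c r))"
    then show "s2 ''n'' 0 = n" using inp(1) by (simp add: agree_off_def input_def)
  next
    fix s2 assume "s2 ''g'' 0 = c \<and> agree_off ?W s s2 \<and> s2 ''p'' 0 = ?G \<and>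
      s2 ''out'' 0 = of_bool ((\<exists>c' < c. \<exists>r < n. ?acc c' r) \<or> (\<exists>r < n. ?acc c r))"
    then show "s2 ''g'' 0 = c \<and> agree_off ?W s s2 \<and> s2 ''p'' 0 = ?G \<and>
      s2 ''out'' 0 = of_bool (\<exists>c' < Suc c. \<exists>r < n. ?acc c' r)"
      by (auto simp: less_Suc_eq)
  qed (use s1 in \<open>simp_all add: agree_off_def\<close>)
  have guesses: "runs s1 (Seq (count_to ''g'' ''p'' (count_to ''r'' ''n'' try_root)) Skip)
      (5 + Suc ?G * (15 + Suc n * (12 + ?L))) ?Q"
    if s1: "agree_off ?W s s1" "s1 ''p'' 0 = ?G" "s1 ''out'' 0 = 0" for s1
  proof (rule runs_Seq[where ?T1.0 = "3 + Suc ?G * (12 + (3 + Suc n * (12 + ?L)))" and ?T2.0 = 1])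
    show "runs s1 (count_to ''g'' ''p'' (count_to ''r'' ''n'' try_root))
      (3 + Suc ?G * (12 + (3 + Suc n * (12 + ?L)))) (\<lambda>s'. runs s' Skip 1 ?Q)"
    proof (rule runs_count_to[where N = ?G and I = "\<lambda>i s2. agree_off ?W s s2 \<and> s2 ''p'' 0 = ?G \<and>
            s2 ''out'' 0 = of_bool (\<exists>c' < i. \<exists>r < n. ?acc c' r)", OF order_refl])
      fix i s2 assume "i < ?G" "s2 ''g'' 0 = i" "agree_off ?W s s2 \<and> s2 ''p'' 0 = ?G \<and>
            s2 ''out'' 0 = of_bool (\<exists>c' < i. \<exists>r < n. ?acc c' r)"
      then show "runs s2 (count_to ''r'' ''n'' try_root) (3 + Suc n * (12 + ?L))
        (\<lambda>s2. s2 ''g'' 0 = i \<and> agree_off ?W s s2 \<and> s2 ''p'' 0 = ?G \<and>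
          s2 ''out'' 0 = of_bool (\<exists>c' < Suc i. \<exists>r < n. ?acc c' r))"
        using roots by blast
    next
      fix s2 assume "agree_off ?W s s2 \<and> s2 ''p'' 0 = ?G \<and>
            s2 ''out'' 0 = of_bool (\<exists>c' < ?G. \<exists>r < n. ?acc c' r)"
      then show "runs s2 Skip 1 ?Q" by (intro runs_Skip) simp_all
    qed (use s1 in \<open>simp_all add: agree_off_def\<close>)
  qed simp
  let ?double = "assign ''p'' (Add (var ''p'') (var ''p''))"
  have powers: "runs s1 (count_to ''i'' ''k'' (Seq ?double (Seq ?double Skip))) (3 + Suc k * 30)
      (\<lambda>s1. runs s1 (Seq (count_to ''g'' ''p'' (count_to ''r'' ''n'' try_root)) Skip)
        (5 + Suc ?G * (15 + Suc n * (12 + ?L))) ?Q)"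
    if s1: "agree_off ?W s s1" "s1 ''p'' 0 = 1" "s1 ''out'' 0 = 0" for s1
  proof (rule runs_count_to[where N = k and T = 18 and
        I = "\<lambda>i s2. agree_off ?W s s2 \<and> s2 ''p'' 0 = 4 ^ i \<and> s2 ''out'' 0 = 0"])
    fix i s2 assume i: "s2 ''i'' 0 = i"
      "agree_off ?W s s2 \<and> s2 ''p'' 0 = 4 ^ i \<and> s2 ''out'' 0 = 0"
    then show "runs s2 (Seq ?double (Seq ?double Skip)) 18
      (\<lambda>s'. s' ''i'' 0 = i \<and> agree_off ?W s s' \<and> s' ''p'' 0 = 4 ^ Suc i \<and> s' ''out'' 0 = 0)"
      by (intro runs_Write_Seq runs_Skip) (simp_all add: agree_off_def)
  next
    fix i s2 assume "agree_off ?W s s2 \<and> s2 ''p'' 0 = 4 ^ i \<and> s2 ''out'' 0 = 0"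
    then show "s2 ''k'' 0 = k" using inp(1) by (simp add: agree_off_def input_def)
  next
    fix s2 assume "agree_off ?W s s2 \<and> s2 ''p'' 0 = 4 ^ k \<and> s2 ''out'' 0 = 0"
    then show "runs s2 (Seq (count_to ''g'' ''p'' (count_to ''r'' ''n'' try_root)) Skip)
        (5 + Suc ?G * (15 + Suc n * (12 + ?L))) ?Q"
      using guesses by blast
  qed (use s1 in \<open>simp_all add: agree_off_def\<close>)
  \<comment> \<open>The numbers of guesses, roots and search steps multiply, with a cost of order
    \<open>M\<close> per step; lower-order terms are absorbed because every factor is at least
    1.\<close>
  have time: "3 + (3 + Suc k * 30) + (5 + Suc ?G * (15 + Suc n * (12 + ?L)))
    \<le> 500 * (Suc ?G * Suc n * Suc n * M)"
  proof -
    have "27 * 1 \<le> Suc n * (27 * M)"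
      by (simp add: M_def)
    then have "27 + Suc n * (300 * M) \<le> Suc n * (327 * M)" by (simp add: algebra_simps)
    then have "Suc n * (27 + Suc n * (300 * M)) \<le> Suc n * (Suc n * (327 * M))"
      by (rule mult_le_mono2)
    moreover have "15 + Suc n * (12 + Suc n * (300 * M)) \<le> Suc n * (27 + Suc n * (300 * M))"
      by simp
    ultimately have "Suc ?G * (15 + Suc n * (12 + Suc n * (300 * M))) \<le>
        Suc ?G * (Suc n * (Suc n * (327 * M)))"
      by (intro mult_le_mono2) (rule order_trans)
    moreover have "k \<le> ?G" by (simp add: less_imp_le)
    then have "k * 30 \<le> ?G * 41" by (rule mult_le_mono) simp
    then have "3 + (3 + Suc k * 30) + 5 \<le> Suc ?G * 41" by simp
    ultimately have "3 + (3 + Suc k * 30) + (5 + Suc ?G * (15 + Suc n * (12 + Suc n * (300 * M))))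
      \<le> Suc ?G * 41 + Suc ?G * (Suc n * (Suc n * (327 * M)))"
      by linarith
    also have "\<dots> \<le> Suc ?G * (Suc n * (Suc n * (41 * M))) + Suc ?G * (Suc n * (Suc n * (327 * M)))"
      by (intro add_mono mult_le_mono2) (simp_all add: M_def)
    finally show ?thesis by (simp add: M_def algebra_simps)
  qed
  show ?thesis
    unfolding solve_def block.simps M_def[symmetric]
  proof (rule runs_Write_Seq)
    show "runs (s(''p'' := (s ''p'')(aval (Const 0) s := aval (Const 1) s)))
      (Seq (count_to ''i'' ''k'' (Seq ?double (Seq ?double Skip)))
        (Seq (count_to ''g'' ''p'' (count_to ''r'' ''n'' try_root)) Skip))
      (500 * (Suc (4 ^ k) * Suc n * Suc n * M) - (1 + acost (Const 0) + acost (Const 1))) ?Q"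
    proof (rule runs_Seq, rule add_le_imp_le_diff)
      show "3 + Suc k * 30 + (5 + Suc ?G * (15 + Suc n * (12 + ?L))) + (1 + acost (Const 0) + acost (Const 1))
        \<le> 500 * (Suc (4 ^ k) * Suc n * Suc n * M)"
        using time by simp
    qed (rule powers, use assms(4) in \<open>simp_all add: agree_off_def\<close>)
  qed (use time in simp)
qed

text \<open>The exponent \<open>4 * k + 14\<close> collects \<open>4 ^ k\<close> guesses, another
  \<open>4 ^ k\<close> for halving a guess by counting, and a constant 16000 below
  \<open>2 ^ 14\<close>. In \<open>n ^ 4\<close> two factors come from roots and search steps, two
  from the number of arcs.\<close>

theorem corollary2:
  "\<exists>(P :: com) (g :: nat \<Rightarrow> real) (c :: nat).
     g \<in> O(\<lambda>k. real k * (log 2 (real k))\<^sup>2) \<and>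
     (\<forall>(D :: nat pair_pre_digraph) (n :: nat) (es :: (nat \<times> nat) list) (k :: nat).
        pair_digraph D \<longrightarrow> pverts D = {..<n} \<longrightarrow> lists_arcs es D \<longrightarrow>
        strongly_connected (with_proj D) \<longrightarrow> 1 \<le> k \<longrightarrow>
        (\<exists>t s. exec P (init_store n es k) t s \<and>
               real t \<le> 2 powr g k * real n ^ c \<and>
               answer s = (if has_leafy_out_branching (with_proj D) k then 1 else 0)))"
proof (rule exI[of _ solve], rule exI[of _ "\<lambda>k. 4 * real k + 14"], rule exI[of _ 4], intro conjI allI impI)
  show "(\<lambda>k. 4 * real k + 14) \<in> O(\<lambda>k. real k * (log 2 (real k))\<^sup>2)"
  \<comment> \<open>At \<open>k = 1\<close> the logarithm vanishes; from \<open>k = 2\<close> on it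
    is at least 1, and \<open>4 * k + 14 <= 18 * k\<close>.\<close>
  proof (rule bigoI[where c = 18])
    show "\<forall>\<^sub>F k in sequentially. norm (4 * real k + 14) \<le> 18 * norm (real k * (log 2 (real k))\<^sup>2)"
      using eventually_ge_at_top[of 2]
    proof eventually_elim
      fix k :: nat assume k: "2 \<le> k"
      then have "1 \<le> log 2 (real k)" by (simp add: le_log_iff)
      then have "1 \<le> (log 2 (real k))\<^sup>2" by (rule one_le_power)
      then have "real k * 1 \<le> real k * (log 2 (real k))\<^sup>2" by (intro mult_left_mono) auto
      moreover have "2 \<le> real k" using k by simp
      moreover have "norm (real k * (log 2 (real k))\<^sup>2) = real k * (log 2 (real k))\<^sup>2"
        "norm (4 * real k + 14) = 4 * real k + 14" by simp_all
      ultimately show "norm (4 * real k + 14) \<le> 18 * norm (real k * (log 2 (real k))\<^sup>2)"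
        by linarith
    qed
  qed
next
  fix D :: "nat pair_pre_digraph" and n k :: nat and es :: "(nat \<times> nat) list"
  assume D: "pair_digraph D" and verts: "pverts D = {..<n}" and arcs: "lists_arcs es D"
    and conn: "strongly_connected (with_proj D)"
  interpret D: pair_digraph D by (rule D)
  have es: "distinct es" "set es = parcs D" using arcs by (simp_all add: lists_arcs_def)
  have sub: "set es \<subseteq> {..<n} \<times> {..<n}"
    using D.in_arcsD1 D.in_arcsD2 by (auto simp: es verts)
  \<comment> \<open>A strongly connected digraph is nonempty; this later allows
    \<open>Suc n <= 2 * n\<close> and absorbs additive constants into \<open>n ^ 2\<close>.\<close>
  have "0 < n" using conn verts by (auto simp: strongly_connected_def)
  have "length es \<le> n * n"
    using card_mono[OF _ sub] distinct_card[OF es(1)] by simp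
  define s where "s = init_store n es k"
  have "input n es k s" "s ''out'' 0 = 0" by (simp_all add: s_def init_store_def input_def)
  moreover have "snd ` set es \<subseteq> {..<n}" using sub by auto
  ultimately obtain t s' where t: "exec solve s t s'"
    "t \<le> 500 * (Suc (4 ^ k) * Suc n * Suc n * (4 ^ k + length es + 2))"
    and out: "s' ''out'' 0 = of_bool (\<exists>c < 4 ^ k. \<exists>r < n. accepts es k c {r} [r] 0 False)"
    using runs_solve[OF _ es(1)] unfolding runs_def by blast
  \<comment> \<open>Soundness and completeness hold for each root separately, so the quantifiers
    over guesses and roots are exchanged.\<close>
  have "(\<exists>c < 4 ^ k. \<exists>r < n. accepts es k c {r} [r] 0 False) \<longleftrightarrow>
      (\<exists>r < n. \<exists>X. k \<le> card (reach (set es) r X - X))"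
    using accepts_iff[OF es(1), of k] D.pair_no_loops by (auto simp: es(2)) (metis fst_conv snd_conv)+
  also have "\<dots> \<longleftrightarrow> has_leafy_out_branching (with_proj D) k"
    using has_leafy_out_branching_iff[OF D conn] by (simp add: es(2) verts Bex_def)
  finally have answer: "answer s' = (if has_leafy_out_branching (with_proj D) k then 1 else 0)"
    using out by (simp add: answer_def)
  have "t \<le> 500 * ((2 * 4 ^ k) * (2 * n) * (2 * n) * (4 * (4 ^ k * n ^ 2)))"
  proof (rule order_trans[OF t(2)], intro mult_le_mono order_refl)
    have "n ^ 2 \<le> 4 ^ k * n ^ 2" "4 ^ k \<le> 4 ^ k * n ^ 2" "1 \<le> 4 ^ k * n ^ 2"
      using \<open>0 < n\<close> by simp_all
    moreover have "length es \<le> n ^ 2" using \<open>length es \<le> n * n\<close> by (simp add: power2_eq_square)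
    ultimately show "4 ^ k + length es + 2 \<le> 4 * (4 ^ k * n ^ 2)" by linarith
  qed (use \<open>0 < n\<close> in simp_all)
  also have "\<dots> = 16000 * (4 ^ k * 4 ^ k) * n ^ 4"
    by (simp add: power2_eq_square power4_eq_xxxx)
  also have "\<dots> \<le> 2 ^ 14 * (4 ^ k * 4 ^ k) * n ^ 4"
    by (intro mult_le_mono) simp_all
  also have "(4::nat) ^ k * 4 ^ k = 2 ^ (4 * k)"
    by (simp add: power_mult flip: power_mult_distrib)
  also have "2 ^ 14 * 2 ^ (4 * k) * n ^ 4 = 2 ^ (4 * k + 14) * n ^ 4"
    by (simp only: power_add mult.commute)
  finally have "real t \<le> real (2 ^ (4 * k + 14) * n ^ 4)" by (simp only: of_nat_le_iff)
  also have "\<dots> = 2 powr (4 * real k + 14) * real n ^ 4"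
    using powr_realpow[of 2 "4 * k + 14"] by simp
  finally show "\<exists>t s. exec solve (init_store n es k) t s \<and>
      real t \<le> 2 powr (4 * real k + 14) * real n ^ 4 \<and>
      answer s = (if has_leafy_out_branching (with_proj D) k then 1 else 0)"
    using t(1) answer unfolding s_def by blast
qed

end
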